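(* Let $T$ be a set of $\mathcal{L}^\mathrm{II}_{\omega,\omega}$-sentences and let $\varphi(\bm{v}^\mathsf{p},\bm{v}^\mathsf{s})$ and $\psi(\bm{v}^\mathsf{p},\bm{v}^\mathsf{s})$ be $\mathcal{L}^\mathrm{II}_{\omega,\omega}$-formulas. Then the following are equivalent: (1) whenever $\langle X,r,A\rangle$ and $\langle Y,s,B\rangle$ are models of $T$ and $(f,g)$ is a dense Chu transform from $\langle X,r,A\rangle$ to $\langle Y,s,B\rangle$, then for all tuples $\bm{x}$ in $X$ and $\bm{b}$ in $B$, \[ \langle X,r,A\rangle\models\varphi[\bm{x},g(\bm{b})]\implies\langle Y,s,B\rangle\models\psi[f(\bm{x}),\bm{b}]; \] (2) there exists a first-order inconsistency-flow formula $\theta(\bm{v}^\mathsf{p},\bm{v}^\mathsf{s})$ such that \[ T\vdash\forall\bm{v}^\mathsf{p}\forall\bm{v}^\mathsf{s}\bigl((\varphi\rightarrow\theta)\land(\theta\rightarrow\psi)\bigr). \]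
   Context: A Chu space is a triple $\langle X,r,A\rangle$ with $r\subseteq X\times A$, viewed as a two-sorted structure (disjoint sorts: points $X$, states $A$) for the two-sorted language with point variables $v^\mathsf{p}$, state variables $v^\mathsf{s}$, equality in each sort and a binary relation symbol $R$ (between a point and a state) interpreted as $r$; $\mathcal{L}^\mathrm{II}_{\omega,\omega}$ is first-order two-sorted logic in this language. A Chu transform from $\langle X,r,A\rangle$ to $\langle Y,s,B\rangle$ is a pair $f\colon X\to Y$, $g\colon B\to A$ with $\langle x,g(b)\rangle\in r\iff\langle f(x),b\rangle\in s$ for all $x\in X$, $b\in B$; it is dense if for every $b\in B$, if some $y\in Y$ has $\langle y,b\rangle\in s$, then some $x\in X$ has $\langle f(x),b\rangle\in s$. $f(\bm{x})$, $g(\bm{b})$ denote pointwise application. First-order inconsistency-flow formulas are built recursively from the formulas $(v^\mathsf{p}_0=v^\mathsf{p}_1)$, $\lnot(v^\mathsf{s}_0=v^\mathsf{s}_1)$, $R(v^\mathsf{p},v^\mathsf{s})$, $\lnot R(v^\mathsf{p},v^\mathsf{s})$, $\lnot\exists v^\mathsf{p}R(v^\mathsf{p},v^\mathsf{s})$ using finite conjunctions, finite disjunctions, and the quantifiers $\exists v^\mathsf{p}$ and $\forall v^\mathsf{s}$. *)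

theory Defs
  imports "HOL-Library.FuncSet"
begin

section \<open>Chu spaces and Chu transforms\<close>

text \<open>The two sorts are disjoint because points and states have different types. Either carrier may
  be empty.\<close>

record ('p, 's) chu =
  points :: "'p set"
  inc :: "('p \<times> 's) set"
  states :: "'s set"

definition chu_space :: "('p, 's) chu \<Rightarrow> bool" where
  "chu_space C \<longleftrightarrow> inc C \<subseteq> points C \<times> states C"

definition chu_transform ::
    "('p, 's) chu \<Rightarrow> ('q, 't) chu \<Rightarrow> ('p \<Rightarrow> 'q) \<Rightarrow> ('t \<Rightarrow> 's) \<Rightarrow> bool" where
  "chu_transform C D f g \<longleftrightarrow>
     f \<in> points C \<rightarrow> points D \<and> g \<in> states D \<rightarrow> states C \<and>
     (\<forall>x\<in>points C. \<forall>b\<in>states D. (x, g b) \<in> inc C \<longleftrightarrow> (f x, b) \<in> inc D)"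

definition dense_chu_transform ::
    "('p, 's) chu \<Rightarrow> ('q, 't) chu \<Rightarrow> ('p \<Rightarrow> 'q) \<Rightarrow> ('t \<Rightarrow> 's) \<Rightarrow> bool" where
  "dense_chu_transform C D f g \<longleftrightarrow>
     chu_transform C D f g \<and>
     (\<forall>b\<in>states D. (\<exists>y\<in>points D. (y, b) \<in> inc D) \<longrightarrow> (\<exists>x\<in>points C. (f x, b) \<in> inc D))"

section \<open>Two-sorted first-order formulas\<close>

text \<open>Variables are de Bruijn indices, counted separately for the two sorts: \<open>AllP\<close> binds the
  point variable \<open>0\<close> and leaves the state variables alone, and \<open>AllS\<close> does the converse. The
  remaining connectives are the usual classical abbreviations.\<close>

datatype fm =
    Bot
  | EqP nat nat
  | EqS nat nat
  | Rel nat nat  \<comment> \<open>point variable, state variable\<close>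
  | Imp fm fm
  | AllP fm
  | AllS fm

abbreviation Neg :: "fm \<Rightarrow> fm" where "Neg \<phi> \<equiv> Imp \<phi> Bot"
abbreviation Top :: fm where "Top \<equiv> Neg Bot"
abbreviation And :: "fm \<Rightarrow> fm \<Rightarrow> fm" where "And \<phi> \<psi> \<equiv> Neg (Imp \<phi> (Neg \<psi>))"
abbreviation Or :: "fm \<Rightarrow> fm \<Rightarrow> fm" where "Or \<phi> \<psi> \<equiv> Imp (Neg \<phi>) \<psi>"
abbreviation ExP :: "fm \<Rightarrow> fm" where "ExP \<phi> \<equiv> Neg (AllP (Neg \<phi>))"
abbreviation ExS :: "fm \<Rightarrow> fm" where "ExS \<phi> \<equiv> Neg (AllS (Neg \<phi>))"

text \<open>\<open>wff m n \<phi>\<close>: the free point variables of \<open>\<phi>\<close> are among \<open>0, ..., m - 1\<close> and its free state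
  variables among \<open>0, ..., n - 1\<close>.\<close>

fun wff :: "nat \<Rightarrow> nat \<Rightarrow> fm \<Rightarrow> bool" where
  "wff m n Bot \<longleftrightarrow> True"
| "wff m n (EqP i j) \<longleftrightarrow> i < m \<and> j < m"
| "wff m n (EqS i j) \<longleftrightarrow> i < n \<and> j < n"
| "wff m n (Rel i j) \<longleftrightarrow> i < m \<and> j < n"
| "wff m n (Imp \<phi> \<psi>) \<longleftrightarrow> wff m n \<phi> \<and> wff m n \<psi>"
| "wff m n (AllP \<phi>) \<longleftrightarrow> wff (Suc m) n \<phi>"
| "wff m n (AllS \<phi>) \<longleftrightarrow> wff m (Suc n) \<phi>"

abbreviation sentence :: "fm \<Rightarrow> bool" where "sentence \<equiv> wff 0 0"

definition univ_closure :: "nat \<Rightarrow> nat \<Rightarrow> fm \<Rightarrow> fm" where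
  "univ_closure m n \<phi> = (AllP ^^ m) ((AllS ^^ n) \<phi>)"

section \<open>Satisfaction\<close>

fun sat :: "('p, 's) chu \<Rightarrow> (nat \<Rightarrow> 'p) \<Rightarrow> (nat \<Rightarrow> 's) \<Rightarrow> fm \<Rightarrow> bool" where
  "sat C e d Bot \<longleftrightarrow> False"
| "sat C e d (EqP i j) \<longleftrightarrow> e i = e j"
| "sat C e d (EqS i j) \<longleftrightarrow> d i = d j"
| "sat C e d (Rel i j) \<longleftrightarrow> (e i, d j) \<in> inc C"
| "sat C e d (Imp \<phi> \<psi>) \<longleftrightarrow> (sat C e d \<phi> \<longrightarrow> sat C e d \<psi>)"
| "sat C e d (AllP \<phi>) \<longleftrightarrow> (\<forall>x\<in>points C. sat C (case_nat x e) d \<phi>)"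
| "sat C e d (AllS \<phi>) \<longleftrightarrow> (\<forall>a\<in>states C. sat C e (case_nat a d) \<phi>)"

text \<open>Satisfaction by tuples. It is meaningful only for formulas whose free variables lie within the
  lengths of the two tuples, since \<open>(!)\<close> is unspecified beyond the length of a list.\<close>

definition holds :: "('p, 's) chu \<Rightarrow> 'p list \<Rightarrow> 's list \<Rightarrow> fm \<Rightarrow> bool" where
  "holds C xs as \<phi> \<longleftrightarrow> sat C ((!) xs) ((!) as) \<phi>"

definition models :: "('p, 's) chu \<Rightarrow> fm set \<Rightarrow> bool" where
  "models C T \<longleftrightarrow> chu_space C \<and> (\<forall>\<sigma>\<in>T. holds C [] [] \<sigma>)"

section \<open>Derivability\<close>

text \<open>Variables are the only terms, so that substitution of terms for variables is renaming.\<close>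

fun ren :: "(nat \<Rightarrow> nat) \<Rightarrow> (nat \<Rightarrow> nat) \<Rightarrow> fm \<Rightarrow> fm" where
  "ren \<rho> \<pi> Bot = Bot"
| "ren \<rho> \<pi> (EqP i j) = EqP (\<rho> i) (\<rho> j)"
| "ren \<rho> \<pi> (EqS i j) = EqS (\<pi> i) (\<pi> j)"
| "ren \<rho> \<pi> (Rel i j) = Rel (\<rho> i) (\<pi> j)"
| "ren \<rho> \<pi> (Imp \<phi> \<psi>) = Imp (ren \<rho> \<pi> \<phi>) (ren \<rho> \<pi> \<psi>)"
| "ren \<rho> \<pi> (AllP \<phi>) = AllP (ren (case_nat 0 (Suc \<circ> \<rho>)) \<pi> \<phi>)"
| "ren \<rho> \<pi> (AllS \<phi>) = AllS (ren \<rho> (case_nat 0 (Suc \<circ> \<pi>)) \<phi>)"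

abbreviation liftP :: "fm \<Rightarrow> fm" where "liftP \<equiv> ren Suc id"
abbreviation liftS :: "fm \<Rightarrow> fm" where "liftS \<equiv> ren id Suc"

text \<open>\<open>instP i \<phi>\<close> puts the point variable \<open>i\<close> for the variable \<open>0\<close> of \<open>\<phi>\<close>, the body of a quantifier,
  and lowers the other point variables by one.\<close>

abbreviation instP :: "nat \<Rightarrow> fm \<Rightarrow> fm" where "instP i \<equiv> ren (case_nat i id) id"
abbreviation instS :: "nat \<Rightarrow> fm \<Rightarrow> fm" where "instS i \<equiv> ren id (case_nat i id)"

text \<open>Classical natural deduction with equality in a context of \<open>m\<close> point variables and \<open>n\<close> state
  variables. A quantifier may only be instantiated by a variable of the context, and variables enter
  the context only through quantifier introduction. This is the standard way to keep many-sorted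
  derivability sound for structures with empty sorts: \<open>ExP Top\<close> is not derivable. The usual calculus
  for nonempty sorts is recovered by adding the sentences \<open>ExP Top\<close> and \<open>ExS Top\<close> to the hypotheses.\<close>

inductive deriv :: "nat \<Rightarrow> nat \<Rightarrow> fm set \<Rightarrow> fm \<Rightarrow> bool" where
  Assm: "\<phi> \<in> \<Gamma> \<Longrightarrow> wff m n \<phi> \<Longrightarrow> deriv m n \<Gamma> \<phi>"
| ImpI: "wff m n \<phi> \<Longrightarrow> deriv m n (insert \<phi> \<Gamma>) \<psi> \<Longrightarrow> deriv m n \<Gamma> (Imp \<phi> \<psi>)"
| ImpE: "deriv m n \<Gamma> (Imp \<phi> \<psi>) \<Longrightarrow> deriv m n \<Gamma> \<phi> \<Longrightarrow> deriv m n \<Gamma> \<psi>"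
| Raa: "wff m n \<phi> \<Longrightarrow> deriv m n (insert (Neg \<phi>) \<Gamma>) Bot \<Longrightarrow> deriv m n \<Gamma> \<phi>"
| AllPI: "deriv (Suc m) n (liftP ` \<Gamma>) \<phi> \<Longrightarrow> deriv m n \<Gamma> (AllP \<phi>)"
| AllPE: "deriv m n \<Gamma> (AllP \<phi>) \<Longrightarrow> i < m \<Longrightarrow> deriv m n \<Gamma> (instP i \<phi>)"
| AllSI: "deriv m (Suc n) (liftS ` \<Gamma>) \<phi> \<Longrightarrow> deriv m n \<Gamma> (AllS \<phi>)"
| AllSE: "deriv m n \<Gamma> (AllS \<phi>) \<Longrightarrow> i < n \<Longrightarrow> deriv m n \<Gamma> (instS i \<phi>)"
| EqPI: "i < m \<Longrightarrow> deriv m n \<Gamma> (EqP i i)"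
| EqPE: "deriv m n \<Gamma> (EqP i j) \<Longrightarrow> wff (Suc m) n \<phi> \<Longrightarrow> deriv m n \<Gamma> (instP i \<phi>) \<Longrightarrow>
    deriv m n \<Gamma> (instP j \<phi>)"
| EqSI: "i < n \<Longrightarrow> deriv m n \<Gamma> (EqS i i)"
| EqSE: "deriv m n \<Gamma> (EqS i j) \<Longrightarrow> wff m (Suc n) \<phi> \<Longrightarrow> deriv m n \<Gamma> (instS i \<phi>) \<Longrightarrow>
    deriv m n \<Gamma> (instS j \<phi>)"

definition proves :: "fm set \<Rightarrow> fm \<Rightarrow> bool"  (infix "\<turnstile>" 50) where
  "T \<turnstile> \<sigma> \<longleftrightarrow> deriv 0 0 T \<sigma>"

section \<open>First-order inconsistency-flow formulas\<close>

text \<open>\<open>Top\<close> and \<open>Bot\<close> are the empty conjunction and the empty disjunction.\<close>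

inductive flow :: "fm \<Rightarrow> bool" where
  "flow (EqP i j)"
| "flow (Neg (EqS i j))"
| "flow (Rel i j)"
| "flow (Neg (Rel i j))"
| "flow (Neg (ExP (Rel 0 j)))"
| "flow Top"
| "flow \<phi> \<Longrightarrow> flow \<psi> \<Longrightarrow> flow (And \<phi> \<psi>)"
| "flow Bot"
| "flow \<phi> \<Longrightarrow> flow \<psi> \<Longrightarrow> flow (Or \<phi> \<psi>)"
| "flow \<phi> \<Longrightarrow> flow (ExP \<phi>)"
| "flow \<phi> \<Longrightarrow> flow (AllS \<phi>)"

end

theory Submission
  imports Defs "HOL-Library.Countable"
begin

text \<open>
  Call a theory \<open>\<Gamma>\<close> of the source and a theory \<open>\<Delta>\<close> of the target inseparable if no flow formula in
  the shared names is provable from \<open>\<Gamma>\<close> and refutable from \<open>\<Delta>\<close>. If there is no interpolant, then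
  \<open>T, \<phi>\<close> and \<open>T, \<not>\<psi>\<close> are inseparable. Inseparability survives deciding a formula on either side
  (flow formulas are closed under \<open>\<or>\<close> and \<open>\<and>\<close>) and adding witnesses: a new source point is also a
  target point, and a new target state is also a source state, so that these are shared and are
  quantified away by \<open>\<exists>\<close> over points and \<open>\<forall>\<close> over states. In the limit one gets two Henkin theories,
  with every shared flow formula passing from the first to the second. For the atomic ones this says
  that the names induce a dense Chu transform between the (countable) term models.
\<close>

section \<open>Free variables and renaming\<close>

text \<open>A shared name is a variable of both theories at once: for a point, its value in the
  target is to be the image under f of its value in the source; for a state, its value in the source
  is to be the image under g of its value in the target. Each kind of basic flow formula then yields
  one condition on the pair: \<open>EqP\<close> makes f well defined on classes of names, negated
  \<open>EqS\<close> does the same for g, \<open>Rel\<close> and its negation give the Chu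
  condition, and the remaining kind, read contrapositively, gives density. \<open>Bot\<close> and
  \<open>Top\<close> keep the two theories consistent. New source states and new target points stay
  private to their side, so a separator never mentions them and no quantifier is required for them.
  Carriers may be empty, so names cannot be taken for granted: every derivation carries the sets of
  names it may use, and these grow with the witnesses. There are countably many formulas, so one
  sequence of stages suffices, each with finitely many names; infinite carrier types leave room for
  the resulting countable models.\<close>

fun fvP :: "fm \<Rightarrow> nat set" where
  "fvP Bot = {}"
| "fvP (EqP i j) = {i, j}"
| "fvP (EqS i j) = {}"
| "fvP (Rel i j) = {i}"
| "fvP (Imp \<phi> \<psi>) = fvP \<phi> \<union> fvP \<psi>"
| "fvP (AllP \<phi>) = Suc -` fvP \<phi>"
| "fvP (AllS \<phi>) = fvP \<phi>"

fun fvS :: "fm \<Rightarrow> nat set" where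
  "fvS Bot = {}"
| "fvS (EqP i j) = {}"
| "fvS (EqS i j) = {i, j}"
| "fvS (Rel i j) = {j}"
| "fvS (Imp \<phi> \<psi>) = fvS \<phi> \<union> fvS \<psi>"
| "fvS (AllP \<phi>) = fvS \<phi>"
| "fvS (AllS \<phi>) = Suc -` fvS \<phi>"

text \<open>Arbitrary sets of names replace the initial segments of \<open>wff\<close>. Going
  through free variables makes monotonicity immediate and lets a formula be located at a stage by
  its finitely many names; the recursion equations return as simp rules.\<close>

definition wfn :: "nat set \<Rightarrow> nat set \<Rightarrow> fm \<Rightarrow> bool" where
  "wfn P S \<phi> \<longleftrightarrow> fvP \<phi> \<subseteq> P \<and> fvS \<phi> \<subseteq> S"

abbreviation up :: "nat set \<Rightarrow> nat set" where "up X \<equiv> insert 0 (Suc ` X)"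

lemma subset_up_iff: "F \<subseteq> up X \<longleftrightarrow> Suc -` F \<subseteq> X"
proof
  assume "Suc -` F \<subseteq> X"
  show "F \<subseteq> up X"
  proof
    fix i assume "i \<in> F"
    then show "i \<in> up X" using \<open>Suc -` F \<subseteq> X\<close> by (cases i) auto
  qed
qed auto

lemma wfn_simps [simp]:
  "wfn P S Bot"
  "wfn P S (EqP i j) \<longleftrightarrow> i \<in> P \<and> j \<in> P"
  "wfn P S (EqS i j) \<longleftrightarrow> i \<in> S \<and> j \<in> S"
  "wfn P S (Rel i j) \<longleftrightarrow> i \<in> P \<and> j \<in> S"
  "wfn P S (Imp \<phi> \<psi>) \<longleftrightarrow> wfn P S \<phi> \<and> wfn P S \<psi>"
  "wfn P S (AllP \<phi>) \<longleftrightarrow> wfn (up P) S \<phi>"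
  "wfn P S (AllS \<phi>) \<longleftrightarrow> wfn P (up S) \<phi>"
  unfolding wfn_def fvP.simps fvS.simps subset_up_iff by auto

lemma up_lessThan: "up {..<m} = {..<Suc m}"
  by (simp add: lessThan_Suc_eq_insert_0)

lemma wff_iff_wfn: "wff m n \<phi> \<longleftrightarrow> wfn {..<m} {..<n} \<phi>"
  by (induction m n \<phi> rule: wff.induct) (simp_all add: up_lessThan)

lemma wfn_mono: "wfn P S \<phi> \<Longrightarrow> P \<subseteq> P' \<Longrightarrow> S \<subseteq> S' \<Longrightarrow> wfn P' S' \<phi>"
  by (auto simp: wfn_def)

lemma finite_fvP: "finite (fvP \<phi>)"
  by (induction \<phi>) (auto intro: finite_vimageI)

lemma finite_fvS: "finite (fvS \<phi>)"
  by (induction \<phi>) (auto intro: finite_vimageI)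

lemma vimage_Suc_lift: "Suc -` (case_nat 0 (Suc \<circ> \<rho>) ` F) = \<rho> ` (Suc -` F)"
proof -
  have *: "Suc k = case_nat 0 (Suc \<circ> \<rho>) i \<longleftrightarrow> (\<exists>j. i = Suc j \<and> k = \<rho> j)" for k i
    by (cases i) auto
  show ?thesis by (rule set_eqI) (auto simp: image_iff *)
qed

lemma fvP_ren [simp]: "fvP (ren \<rho> \<pi> \<phi>) = \<rho> ` fvP \<phi>"
  by (induction \<phi> arbitrary: \<rho> \<pi>) (auto simp: vimage_Suc_lift)

lemma fvS_ren [simp]: "fvS (ren \<rho> \<pi> \<phi>) = \<pi> ` fvS \<phi>"
  by (induction \<phi> arbitrary: \<rho> \<pi>) (auto simp: vimage_Suc_lift)

lemma wfn_ren: "wfn P S \<phi> \<Longrightarrow> \<rho> ` P \<subseteq> P' \<Longrightarrow> \<pi> ` S \<subseteq> S' \<Longrightarrow> wfn P' S' (ren \<rho> \<pi> \<phi>)"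
  unfolding wfn_def fvP_ren fvS_ren by (meson image_mono order_trans)

lemma case_nat_comp_lift: "case_nat c \<sigma> \<circ> case_nat 0 (Suc \<circ> \<rho>) = case_nat c (\<sigma> \<circ> \<rho>)"
  by (auto simp: fun_eq_iff split: nat.splits)

lemma lift_comp: "case_nat 0 (Suc \<circ> \<rho>) \<circ> case_nat 0 (Suc \<circ> \<rho>') = case_nat 0 (Suc \<circ> (\<rho> \<circ> \<rho>'))"
  by (auto simp: fun_eq_iff split: nat.splits)

lemma ren_ren: "ren \<rho> \<pi> (ren \<rho>' \<pi>' \<phi>) = ren (\<rho> \<circ> \<rho>') (\<pi> \<circ> \<pi>') \<phi>"
  by (induction \<phi> arbitrary: \<rho> \<pi> \<rho>' \<pi>') (simp_all add: lift_comp)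

lemma ren_cong:
  "(\<And>i. i \<in> fvP \<phi> \<Longrightarrow> \<rho> i = \<rho>' i) \<Longrightarrow> (\<And>j. j \<in> fvS \<phi> \<Longrightarrow> \<pi> j = \<pi>' j) \<Longrightarrow>
    ren \<rho> \<pi> \<phi> = ren \<rho>' \<pi>' \<phi>"
proof (induction \<phi> arbitrary: \<rho> \<pi> \<rho>' \<pi>')
  case (AllP \<phi>)
  have "ren (case_nat 0 (Suc \<circ> \<rho>)) \<pi> \<phi> = ren (case_nat 0 (Suc \<circ> \<rho>')) \<pi>' \<phi>"
    using AllP.prems by (intro AllP.IH) (auto split: nat.splits)
  then show ?case by simp
next
  case (AllS \<phi>)
  have "ren \<rho> (case_nat 0 (Suc \<circ> \<pi>)) \<phi> = ren \<rho>' (case_nat 0 (Suc \<circ> \<pi>')) \<phi>"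
    using AllS.prems by (intro AllS.IH) (auto split: nat.splits)
  then show ?case by simp
next
  case (Imp \<phi> \<psi>)
  have "ren \<rho> \<pi> \<phi> = ren \<rho>' \<pi>' \<phi>" "ren \<rho> \<pi> \<psi> = ren \<rho>' \<pi>' \<psi>"
    using Imp.prems by (intro Imp.IH; simp)+
  then show ?case by simp
qed auto

lemma ren_id [simp]: "ren id id \<phi> = \<phi>"
proof -
  have lift: "case_nat 0 (Suc \<circ> id) = id" by (auto simp: fun_eq_iff split: nat.splits)
  show ?thesis by (induction \<phi>) (simp_all only: ren.simps lift, simp_all)
qed

lemma wfn_instP: "wfn (up P) S \<phi> \<Longrightarrow> i \<in> P \<Longrightarrow> wfn P S (instP i \<phi>)"
  by (erule wfn_ren) auto

lemma wfn_instS: "wfn P (up S) \<phi> \<Longrightarrow> i \<in> S \<Longrightarrow> wfn P S (instS i \<phi>)"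
  by (erule wfn_ren) auto

lemma ren_instP: "ren \<rho> \<pi> (instP i \<phi>) = instP (\<rho> i) (ren (case_nat 0 (Suc \<circ> \<rho>)) \<pi> \<phi>)"
proof -
  have "\<rho> \<circ> case_nat i id = case_nat (\<rho> i) id \<circ> case_nat 0 (Suc \<circ> \<rho>)"
    by (auto simp: fun_eq_iff split: nat.splits)
  then show ?thesis by (simp add: ren_ren)
qed

lemma ren_instS: "ren \<rho> \<pi> (instS i \<phi>) = instS (\<pi> i) (ren \<rho> (case_nat 0 (Suc \<circ> \<pi>)) \<phi>)"
proof -
  have "\<pi> \<circ> case_nat i id = case_nat (\<pi> i) id \<circ> case_nat 0 (Suc \<circ> \<pi>)"
    by (auto simp: fun_eq_iff split: nat.splits)
  then show ?thesis by (simp add: ren_ren)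
qed

text \<open>\<open>absv c\<close> undoes the substitution of a fresh variable \<open>c\<close> for the bound variable \<open>0\<close>.\<close>

definition absv :: "nat \<Rightarrow> nat \<Rightarrow> nat" where
  "absv c i = (if i = c then 0 else Suc i)"

lemma absv_image: "absv c ` insert c X \<subseteq> up X"
  by (auto simp: absv_def)

lemma instP_absv: "instP c (ren (absv c) id \<phi>) = \<phi>"
proof -
  have "case_nat c id \<circ> absv c = id" by (auto simp: fun_eq_iff absv_def)
  then show ?thesis by (simp add: ren_ren)
qed

lemma instS_absv: "instS c (ren id (absv c) \<phi>) = \<phi>"
proof -
  have "case_nat c id \<circ> absv c = id" by (auto simp: fun_eq_iff absv_def)
  then show ?thesis by (simp add: ren_ren)
qed

text \<open>Freshness matters here: were \<open>c\<close> already in use, instantiation would merge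
  it with the bound variable and abstraction could not tell them apart. Writing the right side as an
  identity renaming leaves only values at free variables to compare.\<close>

lemma absv_instP: "wfn (up P) S \<phi> \<Longrightarrow> c \<notin> P \<Longrightarrow> ren (absv c) id (instP c \<phi>) = \<phi>"
  unfolding ren_ren by (subst (2) ren_id[symmetric], rule ren_cong)
    (auto simp: wfn_def absv_def split: nat.splits)

lemma absv_instS: "wfn P (up S) \<phi> \<Longrightarrow> c \<notin> S \<Longrightarrow> ren id (absv c) (instS c \<phi>) = \<phi>"
  unfolding ren_ren by (subst (2) ren_id[symmetric], rule ren_cong)
    (auto simp: wfn_def absv_def split: nat.splits)

lemma absv_liftP: "wfn P S \<phi> \<Longrightarrow> c \<notin> P \<Longrightarrow> ren (absv c) id \<phi> = liftP \<phi>"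
  by (rule ren_cong) (auto simp: wfn_def absv_def)

lemma absv_liftS: "wfn P S \<phi> \<Longrightarrow> c \<notin> S \<Longrightarrow> ren id (absv c) \<phi> = liftS \<phi>"
  by (rule ren_cong) (auto simp: wfn_def absv_def)

section \<open>Derivability in named contexts\<close>

text \<open>The calculus \<open>deriv\<close> with arbitrary sets of variables as contexts, so that the two sides of
  the construction below can name their witnesses independently.\<close>

inductive nderiv :: "nat set \<Rightarrow> nat set \<Rightarrow> fm set \<Rightarrow> fm \<Rightarrow> bool" where
  Assm: "\<phi> \<in> \<Gamma> \<Longrightarrow> wfn P S \<phi> \<Longrightarrow> nderiv P S \<Gamma> \<phi>"
| ImpI: "wfn P S \<phi> \<Longrightarrow> nderiv P S (insert \<phi> \<Gamma>) \<psi> \<Longrightarrow> nderiv P S \<Gamma> (Imp \<phi> \<psi>)"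
| ImpE: "nderiv P S \<Gamma> (Imp \<phi> \<psi>) \<Longrightarrow> nderiv P S \<Gamma> \<phi> \<Longrightarrow> nderiv P S \<Gamma> \<psi>"
| Raa: "wfn P S \<phi> \<Longrightarrow> nderiv P S (insert (Neg \<phi>) \<Gamma>) Bot \<Longrightarrow> nderiv P S \<Gamma> \<phi>"
| AllPI: "nderiv (up P) S (liftP ` \<Gamma>) \<phi> \<Longrightarrow> nderiv P S \<Gamma> (AllP \<phi>)"
| AllPE: "nderiv P S \<Gamma> (AllP \<phi>) \<Longrightarrow> i \<in> P \<Longrightarrow> nderiv P S \<Gamma> (instP i \<phi>)"
| AllSI: "nderiv P (up S) (liftS ` \<Gamma>) \<phi> \<Longrightarrow> nderiv P S \<Gamma> (AllS \<phi>)"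
| AllSE: "nderiv P S \<Gamma> (AllS \<phi>) \<Longrightarrow> i \<in> S \<Longrightarrow> nderiv P S \<Gamma> (instS i \<phi>)"
| EqPI: "i \<in> P \<Longrightarrow> nderiv P S \<Gamma> (EqP i i)"
| EqPE: "nderiv P S \<Gamma> (EqP i j) \<Longrightarrow> wfn (up P) S \<phi> \<Longrightarrow> nderiv P S \<Gamma> (instP i \<phi>) \<Longrightarrow>
    nderiv P S \<Gamma> (instP j \<phi>)"
| EqSI: "i \<in> S \<Longrightarrow> nderiv P S \<Gamma> (EqS i i)"
| EqSE: "nderiv P S \<Gamma> (EqS i j) \<Longrightarrow> wfn P (up S) \<phi> \<Longrightarrow> nderiv P S \<Gamma> (instS i \<phi>) \<Longrightarrow>
    nderiv P S \<Gamma> (instS j \<phi>)"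

text \<open>The way back to the official calculus, used once the interpolant has been found. Initial
  segments survive binders because \<open>up\<close> of one is the next.\<close>

lemma nderiv_imp_deriv:
  "nderiv P S \<Gamma> \<phi> \<Longrightarrow> P = {..<m} \<Longrightarrow> S = {..<n} \<Longrightarrow> deriv m n \<Gamma> \<phi>"
proof (induction arbitrary: m n rule: nderiv.induct)
  case (AllPI P S \<Gamma> \<phi>)
  then show ?case by (intro deriv.AllPI AllPI.IH) (simp_all add: up_lessThan)
next
  case (AllSI P S \<Gamma> \<phi>)
  then show ?case by (intro deriv.AllSI AllSI.IH) (simp_all add: up_lessThan)
next
  case (ImpE P S \<Gamma> \<phi> \<psi>)
  then show ?case by (blast intro: deriv.ImpE)
next
  case (EqPE P S \<Gamma> i j \<phi>)
  then show ?case by (intro deriv.EqPE[of m n \<Gamma> i j]) (simp_all add: up_lessThan wff_iff_wfn)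
next
  case (EqSE P S \<Gamma> i j \<phi>)
  then show ?case by (intro deriv.EqSE[of m n \<Gamma> i j]) (simp_all add: up_lessThan wff_iff_wfn)
qed (auto intro: deriv.intros simp: wff_iff_wfn)

text \<open>\<open>Assm\<close> checks the formula it takes from the hypotheses, so conclusions stay
  over the names of the context even when \<Gamma> contains other formulas.\<close>

lemma nderiv_wfn: "nderiv P S \<Gamma> \<phi> \<Longrightarrow> wfn P S \<phi>"
  by (induction rule: nderiv.induct) (auto intro: wfn_instP wfn_instS)

lemma lift_image_up: "\<rho> ` X \<subseteq> X' \<Longrightarrow> case_nat 0 (Suc \<circ> \<rho>) ` up X \<subseteq> up X'"
  by auto

lemma liftP_ren: "liftP (ren \<rho> \<pi> \<phi>) = ren (case_nat 0 (Suc \<circ> \<rho>)) \<pi> (liftP \<phi>)"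
  by (simp add: ren_ren comp_def)

lemma liftS_ren: "liftS (ren \<rho> \<pi> \<phi>) = ren \<rho> (case_nat 0 (Suc \<circ> \<pi>)) (liftS \<phi>)"
  by (simp add: ren_ren comp_def)

text \<open>Variables are the only terms, so this is the substitution lemma, for renamings that need
  not be injective. At the identity it is weakening; at \<open>absv c\<close> it turns a fresh name
  into a bound variable. Allowing a larger \<Gamma>' builds weakening into the induction.\<close>

lemma nderiv_ren:
  "nderiv P S \<Gamma> \<phi> \<Longrightarrow> \<rho> ` P \<subseteq> P' \<Longrightarrow> \<pi> ` S \<subseteq> S' \<Longrightarrow> ren \<rho> \<pi> ` \<Gamma> \<subseteq> \<Gamma>' \<Longrightarrow>
    nderiv P' S' \<Gamma>' (ren \<rho> \<pi> \<phi>)"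
proof (induction arbitrary: \<rho> \<pi> P' S' \<Gamma>' rule: nderiv.induct)
  case (Assm \<phi> \<Gamma> P S)
  then show ?case by (intro nderiv.Assm wfn_ren) auto
next
  case (ImpI P S \<phi> \<Gamma> \<psi>)
  then show ?case unfolding ren.simps
    by (intro nderiv.ImpI ImpI.IH wfn_ren[OF ImpI.hyps(1)]) auto
next
  case (ImpE P S \<Gamma> \<phi> \<psi>)
  then show ?case by (metis nderiv.ImpE ren.simps(5))
next
  case (Raa P S \<phi> \<Gamma>)
  have "nderiv P' S' (insert (Neg (ren \<rho> \<pi> \<phi>)) \<Gamma>') (ren \<rho> \<pi> Bot)"
    using Raa.prems by (intro Raa.IH) auto
  moreover have "wfn P' S' (ren \<rho> \<pi> \<phi>)" using Raa by (blast intro: wfn_ren)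
  ultimately show ?case by (simp add: nderiv.Raa)
next
  case (AllPI P S \<Gamma> \<phi>)
  have "ren (case_nat 0 (Suc \<circ> \<rho>)) \<pi> ` liftP ` \<Gamma> \<subseteq> liftP ` \<Gamma>'"
    using AllPI.prems(3) by (auto simp: liftP_ren[symmetric])
  then show ?case unfolding ren.simps
    using AllPI.prems by (intro nderiv.AllPI AllPI.IH lift_image_up)
next
  case (AllPE P S \<Gamma> \<phi> i)
  then have "nderiv P' S' \<Gamma>' (ren \<rho> \<pi> (AllP \<phi>))" by blast
  then show ?case unfolding ren_instP ren.simps using AllPE.hyps(2) AllPE.prems(1)
    by (intro nderiv.AllPE) auto
next
  case (AllSI P S \<Gamma> \<phi>)
  have "ren \<rho> (case_nat 0 (Suc \<circ> \<pi>)) ` liftS ` \<Gamma> \<subseteq> liftS ` \<Gamma>'"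
    using AllSI.prems(3) by (auto simp: liftS_ren[symmetric])
  then show ?case unfolding ren.simps
    using AllSI.prems by (intro nderiv.AllSI AllSI.IH lift_image_up)
next
  case (AllSE P S \<Gamma> \<phi> i)
  then have "nderiv P' S' \<Gamma>' (ren \<rho> \<pi> (AllS \<phi>))" by blast
  then show ?case unfolding ren_instS ren.simps using AllSE.hyps(2) AllSE.prems(2)
    by (intro nderiv.AllSE) auto
next
  case (EqPE P S \<Gamma> i j \<phi>)
  have "nderiv P' S' \<Gamma>' (ren \<rho> \<pi> (EqP i j))" "nderiv P' S' \<Gamma>' (ren \<rho> \<pi> (instP i \<phi>))"
    using EqPE.IH[OF EqPE.prems] by (simp_all only: ren.simps)
  moreover have "wfn (up P') S' (ren (case_nat 0 (Suc \<circ> \<rho>)) \<pi> \<phi>)"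
    using EqPE by (intro wfn_ren[OF EqPE.hyps(2)] lift_image_up)
  ultimately show ?case unfolding ren_instP ren.simps by (metis nderiv.EqPE)
next
  case (EqSE P S \<Gamma> i j \<phi>)
  have "nderiv P' S' \<Gamma>' (ren \<rho> \<pi> (EqS i j))" "nderiv P' S' \<Gamma>' (ren \<rho> \<pi> (instS i \<phi>))"
    using EqSE.IH[OF EqSE.prems] by (simp_all only: ren.simps)
  moreover have "wfn P' (up S') (ren \<rho> (case_nat 0 (Suc \<circ> \<pi>)) \<phi>)"
    using EqSE by (intro wfn_ren[OF EqSE.hyps(2)] lift_image_up)
  ultimately show ?case unfolding ren_instS ren.simps by (metis nderiv.EqSE)
qed (auto intro: nderiv.intros)

lemma nderiv_mono:
  "nderiv P S \<Gamma> \<phi> \<Longrightarrow> P \<subseteq> P' \<Longrightarrow> S \<subseteq> S' \<Longrightarrow> \<Gamma> \<subseteq> \<Gamma>' \<Longrightarrow> nderiv P' S' \<Gamma>' \<phi>"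
  using nderiv_ren[of P S \<Gamma> \<phi> id P' id S' \<Gamma>'] by simp

section \<open>Derived propositional rules\<close>

lemma nderiv_insert: "nderiv P S \<Gamma> \<phi> \<Longrightarrow> nderiv P S (insert \<chi> \<Gamma>) \<phi>"
  by (erule nderiv_mono) auto

lemma nderiv_self: "wfn P S \<phi> \<Longrightarrow> nderiv P S (insert \<phi> \<Gamma>) \<phi>"
  by (simp add: nderiv.Assm)

lemma nderiv_BotE: "nderiv P S \<Gamma> Bot \<Longrightarrow> wfn P S \<phi> \<Longrightarrow> nderiv P S \<Gamma> \<phi>"
  by (rule nderiv.Raa) (auto intro: nderiv_insert)

lemma nderiv_cut: "nderiv P S \<Gamma> \<phi> \<Longrightarrow> nderiv P S (insert \<phi> \<Gamma>) \<psi> \<Longrightarrow> nderiv P S \<Gamma> \<psi>"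
  by (metis nderiv.ImpE nderiv.ImpI nderiv_wfn)

lemma nderiv_NegE: "Neg \<phi> \<in> \<Gamma> \<Longrightarrow> nderiv P S \<Gamma> \<phi> \<Longrightarrow> nderiv P S \<Gamma> Bot"
  by (rule nderiv.ImpE[OF nderiv.Assm]) (auto dest: nderiv_wfn)

text \<open>Assume \<phi> fails. The first derivation then refutes \<chi>, which makes the second
  one available, and that contradicts the assumption.\<close>

lemma nderiv_cases:
  assumes "nderiv P S (insert \<chi> \<Gamma>) \<phi>" "nderiv P S (insert (Neg \<chi>) \<Gamma>) \<phi>" "wfn P S \<chi>"
  shows "nderiv P S \<Gamma> \<phi>"
proof -
  let ?G = "insert (Neg \<phi>) \<Gamma>"
  have wf: "wfn P S \<phi>" using assms(1) by (rule nderiv_wfn)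
  have neg: "nderiv P S (insert \<xi> ?G) Bot" if "nderiv P S (insert \<xi> \<Gamma>) \<phi>" for \<xi>
    by (rule nderiv_NegE[of \<phi>]) (use that in \<open>auto elim: nderiv_mono\<close>)
  have "nderiv P S ?G (Neg \<chi>)" using assms by (intro nderiv.ImpI neg)
  then show ?thesis using nderiv_cut neg[OF assms(2)] nderiv.Raa[OF wf] by blast
qed

lemma nderiv_OrI1: "nderiv P S \<Gamma> \<phi> \<Longrightarrow> wfn P S \<psi> \<Longrightarrow> nderiv P S \<Gamma> (Or \<phi> \<psi>)"
  by (auto intro!: nderiv.ImpI dest: nderiv_wfn
      intro: nderiv_BotE[OF nderiv_NegE[OF insertI1 nderiv_insert]])

lemma nderiv_OrI2: "nderiv P S \<Gamma> \<psi> \<Longrightarrow> wfn P S \<phi> \<Longrightarrow> nderiv P S \<Gamma> (Or \<phi> \<psi>)"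
  by (intro nderiv.ImpI nderiv_insert) auto

lemma nderiv_NotOrI:
  assumes "nderiv P S \<Gamma> (Neg \<phi>)" "nderiv P S \<Gamma> (Neg \<psi>)"
  shows "nderiv P S \<Gamma> (Neg (Or \<phi> \<psi>))"
proof -
  have "wfn P S (Or \<phi> \<psi>)" using assms[THEN nderiv_wfn] by simp
  then show ?thesis
    by (meson assms nderiv.ImpE nderiv.ImpI nderiv_insert nderiv_self)
qed

lemma nderiv_AndI:
  assumes "nderiv P S \<Gamma> \<phi>" "nderiv P S \<Gamma> \<psi>"
  shows "nderiv P S \<Gamma> (And \<phi> \<psi>)"
proof -
  have "wfn P S (Imp \<phi> (Neg \<psi>))" using assms[THEN nderiv_wfn] by simp
  then show ?thesis
    by (meson assms nderiv.ImpE nderiv.ImpI nderiv_insert nderiv_self)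
qed

lemma nderiv_NotAndI1:
  assumes "nderiv P S \<Gamma> (Neg \<phi>)" "wfn P S \<psi>"
  shows "nderiv P S \<Gamma> (Neg (And \<phi> \<psi>))"
proof -
  have wf: "wfn P S \<phi>" using assms(1)[THEN nderiv_wfn] by simp
  have "nderiv P S (insert \<phi> (insert (And \<phi> \<psi>) \<Gamma>)) Bot"
    using nderiv.ImpE[OF nderiv_insert[OF nderiv_insert[OF assms(1)]] nderiv_self[OF wf]] insert_commute
    by metis
  then have "nderiv P S (insert (And \<phi> \<psi>) \<Gamma>) (Imp \<phi> (Neg \<psi>))"
    using wf assms(2) by (simp add: nderiv.ImpI nderiv_BotE)
  then have "nderiv P S (insert (And \<phi> \<psi>) \<Gamma>) Bot" by (rule nderiv_NegE[OF insertI1])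
  then show ?thesis using wf assms(2) by (simp add: nderiv.ImpI)
qed

lemma nderiv_NotAndI2:
  assumes "nderiv P S \<Gamma> (Neg \<psi>)" "wfn P S \<phi>"
  shows "nderiv P S \<Gamma> (Neg (And \<phi> \<psi>))"
proof -
  have wf: "wfn P S \<psi>" using assms(1)[THEN nderiv_wfn] by simp
  have "nderiv P S (insert (And \<phi> \<psi>) \<Gamma>) (Imp \<phi> (Neg \<psi>))"
    by (rule nderiv.ImpI) (use assms in \<open>auto intro: nderiv_insert\<close>)
  then have "nderiv P S (insert (And \<phi> \<psi>) \<Gamma>) Bot" by (rule nderiv_NegE[OF insertI1])
  then show ?thesis using wf assms(2) by (simp add: nderiv.ImpI)
qed

lemma nderiv_NotNotI:
  assumes "nderiv P S \<Gamma> \<phi>"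
  shows "nderiv P S \<Gamma> (Neg (Neg \<phi>))"
  using assms[THEN nderiv_wfn]
  by (intro nderiv.ImpI nderiv.ImpE[OF nderiv_self] nderiv_insert[OF assms]) auto

text \<open>Generalization on a fresh name. Since no hypothesis mentions \<open>c\<close>,
  abstracting it acts on \<Gamma> as \<open>liftP\<close>, and the renamed derivation is a premise
  of \<open>AllPI\<close>.\<close>

lemma nderiv_AllP_fresh:
  assumes "nderiv (insert c P) S \<Gamma> (instP c \<phi>)" "c \<notin> P" "wfn (up P) S \<phi>" "\<forall>\<gamma>\<in>\<Gamma>. wfn P S \<gamma>"
  shows "nderiv P S \<Gamma> (AllP \<phi>)"
proof (rule nderiv.AllPI)
  have "ren (absv c) id ` \<Gamma> \<subseteq> liftP ` \<Gamma>"
    using assms(2,4) by (auto simp: absv_liftP)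
  from nderiv_ren[OF assms(1) absv_image _ this, of S]
  show "nderiv (up P) S (liftP ` \<Gamma>) \<phi>" by (simp add: absv_instP[OF assms(3,2)])
qed

lemma nderiv_AllS_fresh:
  assumes "nderiv P (insert c S) \<Gamma> (instS c \<phi>)" "c \<notin> S" "wfn P (up S) \<phi>" "\<forall>\<gamma>\<in>\<Gamma>. wfn P S \<gamma>"
  shows "nderiv P S \<Gamma> (AllS \<phi>)"
proof (rule nderiv.AllSI)
  have "ren id (absv c) ` \<Gamma> \<subseteq> liftS ` \<Gamma>"
    using assms(2,4) by (auto simp: absv_liftS)
  from nderiv_ren[OF assms(1) _ absv_image this, of P]
  show "nderiv P (up S) (liftS ` \<Gamma>) \<phi>" by (simp add: absv_instS[OF assms(3,2)])
qed

section \<open>Conservativity of Henkin witnesses\<close>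

lemma nderiv_Raa':
  assumes "wfn P S \<chi>" "wfn P S \<phi>" "nderiv P S (insert (Neg \<chi>) \<Gamma>) \<phi>"
  shows "nderiv P S (insert (Neg \<phi>) \<Gamma>) \<chi>"
proof (rule nderiv.Raa[OF assms(1)])
  show "nderiv P S (insert (Neg \<chi>) (insert (Neg \<phi>) \<Gamma>)) Bot"
    using assms by (intro nderiv.ImpE[OF nderiv.Assm nderiv_mono[OF assms(3)]]) auto
qed

text \<open>A fresh witness proves nothing new about the old names. By contraposition, \<not>\<phi>
  yields the instance of \<chi> at \<open>c\<close>; as \<open>c\<close> is fresh this generalizes
  to \<open>AllP \<chi>\<close>, whose negation is a hypothesis.\<close>

lemma nderiv_witnessP:
  assumes "Neg (AllP \<chi>) \<in> \<Gamma>" "nderiv (insert c P) S (insert (Neg (instP c \<chi>)) \<Gamma>) \<phi>"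
    and "c \<notin> P" "\<forall>\<gamma>\<in>\<Gamma>. wfn P S \<gamma>" "wfn P S \<phi>"
  shows "nderiv P S \<Gamma> \<phi>"
proof (rule nderiv.Raa[OF assms(5)])
  have wf: "wfn P S (Neg (AllP \<chi>))" using assms(1,4) by blast
  have "nderiv (insert c P) S (insert (Neg \<phi>) \<Gamma>) (instP c \<chi>)"
  proof (rule nderiv_Raa'[OF _ _ assms(2)])
    show "wfn (insert c P) S (instP c \<chi>)"
      using wf by (intro wfn_instP) (auto elim!: wfn_mono)
    show "wfn (insert c P) S \<phi>" using assms(5) by (auto elim!: wfn_mono)
  qed
  then have "nderiv P S (insert (Neg \<phi>) \<Gamma>) (AllP \<chi>)"
    using assms(3,4,5) wf by (intro nderiv_AllP_fresh) auto
  moreover have "nderiv P S (insert (Neg \<phi>) \<Gamma>) (Neg (AllP \<chi>))"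
    using assms(1) wf by (simp add: nderiv.Assm)
  ultimately show "nderiv P S (insert (Neg \<phi>) \<Gamma>) Bot"
    by (rule nderiv.ImpE[rotated])
qed

lemma nderiv_witnessS:
  assumes "Neg (AllS \<chi>) \<in> \<Gamma>" "nderiv P (insert c S) (insert (Neg (instS c \<chi>)) \<Gamma>) \<phi>"
    and "c \<notin> S" "\<forall>\<gamma>\<in>\<Gamma>. wfn P S \<gamma>" "wfn P S \<phi>"
  shows "nderiv P S \<Gamma> \<phi>"
proof (rule nderiv.Raa[OF assms(5)])
  have wf: "wfn P S (Neg (AllS \<chi>))" using assms(1,4) by blast
  have "nderiv P (insert c S) (insert (Neg \<phi>) \<Gamma>) (instS c \<chi>)"
  proof (rule nderiv_Raa'[OF _ _ assms(2)])
    show "wfn P (insert c S) (instS c \<chi>)"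
      using wf by (intro wfn_instS) (auto elim!: wfn_mono)
    show "wfn P (insert c S) \<phi>" using assms(5) by (auto elim!: wfn_mono)
  qed
  then have "nderiv P S (insert (Neg \<phi>) \<Gamma>) (AllS \<chi>)"
    using assms(3,4,5) wf by (intro nderiv_AllS_fresh) auto
  moreover have "nderiv P S (insert (Neg \<phi>) \<Gamma>) (Neg (AllS \<chi>))"
    using assms(1) wf by (simp add: nderiv.Assm)
  ultimately show "nderiv P S (insert (Neg \<phi>) \<Gamma>) Bot"
    by (rule nderiv.ImpE[rotated])
qed

lemma nderiv_ExPI:
  assumes "nderiv P S \<Gamma> (instP c \<phi>)" "c \<in> P" "wfn (up P) S \<phi>"
  shows "nderiv P S \<Gamma> (ExP \<phi>)"
proof (rule nderiv.ImpI)
  have "nderiv P S (insert (AllP (Neg \<phi>)) \<Gamma>) (instP c (Neg \<phi>))"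
    using assms by (intro nderiv.AllPE nderiv_self) auto
  then show "nderiv P S (insert (AllP (Neg \<phi>)) \<Gamma>) Bot"
    using nderiv.ImpE nderiv_insert[OF assms(1)] by fastforce
qed (use assms in simp)

section \<open>Soundness and preservation\<close>

lemma case_nat_comp: "case_nat x e \<circ> case_nat 0 (Suc \<circ> \<rho>) = case_nat x (e \<circ> \<rho>)"
  by (auto simp: fun_eq_iff split: nat.splits)

lemma sat_ren: "sat C e d (ren \<rho> \<pi> \<phi>) \<longleftrightarrow> sat C (e \<circ> \<rho>) (d \<circ> \<pi>) \<phi>"
  by (induction \<phi> arbitrary: e d \<rho> \<pi>) (simp_all add: case_nat_comp)

lemma sat_cong:
  "(\<And>i. i \<in> fvP \<phi> \<Longrightarrow> e i = e' i) \<Longrightarrow> (\<And>j. j \<in> fvS \<phi> \<Longrightarrow> d j = d' j) \<Longrightarrow>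
    sat C e d \<phi> \<longleftrightarrow> sat C e' d' \<phi>"
proof (induction \<phi> arbitrary: e d e' d')
  case (Imp \<phi> \<psi>)
  have "sat C e d \<phi> = sat C e' d' \<phi>" "sat C e d \<psi> = sat C e' d' \<psi>"
    using Imp.prems by (intro Imp.IH; simp)+
  then show ?case by simp
next
  case (AllP \<phi>)
  have "sat C (case_nat x e) d \<phi> \<longleftrightarrow> sat C (case_nat x e') d' \<phi>" for x
    using AllP.prems by (intro AllP.IH) (auto split: nat.splits)
  then show ?case by simp
next
  case (AllS \<phi>)
  have "sat C e (case_nat x d) \<phi> \<longleftrightarrow> sat C e' (case_nat x d') \<phi>" for x
    using AllS.prems by (intro AllS.IH) (auto split: nat.splits)
  then show ?case by simp
qed auto

lemma sat_instP: "sat C e d (instP i \<phi>) \<longleftrightarrow> sat C (case_nat (e i) e) d \<phi>"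
proof -
  have "e \<circ> case_nat i id = case_nat (e i) e" by (auto simp: fun_eq_iff split: nat.splits)
  then show ?thesis by (simp add: sat_ren)
qed

lemma sat_instS: "sat C e d (instS i \<phi>) \<longleftrightarrow> sat C e (case_nat (d i) d) \<phi>"
proof -
  have "d \<circ> case_nat i id = case_nat (d i) d" by (auto simp: fun_eq_iff split: nat.splits)
  then show ?thesis by (simp add: sat_ren)
qed

lemma sat_liftP: "sat C (case_nat x e) d (liftP \<phi>) \<longleftrightarrow> sat C e d \<phi>"
  by (simp add: sat_ren comp_def)

lemma sat_liftS: "sat C e (case_nat x d) (liftS \<phi>) \<longleftrightarrow> sat C e d \<phi>"
  by (simp add: sat_ren comp_def)

text \<open>Only the variables of the context are required to denote elements, so carriers may be
  empty. Instantiation stays sound because it uses a variable of the context.\<close>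

lemma deriv_sound:
  "deriv m n \<Gamma> \<phi> \<Longrightarrow> \<forall>i<m. e i \<in> points C \<Longrightarrow> \<forall>j<n. d j \<in> states C \<Longrightarrow>
    \<forall>\<gamma>\<in>\<Gamma>. sat C e d \<gamma> \<Longrightarrow> sat C e d \<phi>"
proof (induction arbitrary: e d rule: deriv.induct)
  case (AllPI m n \<Gamma> \<phi>)
  then show ?case by (auto intro!: AllPI.IH simp: sat_liftP less_Suc_eq_0_disj split: nat.splits)
next
  case (AllSI m n \<Gamma> \<phi>)
  then show ?case by (auto intro!: AllSI.IH simp: sat_liftS less_Suc_eq_0_disj split: nat.splits)
next
  case (Raa m n \<phi> \<Gamma>)
  then show ?case by (metis insertE sat.simps(1,5))
next
  case (AllPE m n \<Gamma> \<phi> i)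
  then show ?case unfolding sat_instP by auto
next
  case (AllSE m n \<Gamma> \<phi> i)
  then show ?case unfolding sat_instS by auto
next
  case (EqPE m n \<Gamma> i j \<phi>)
  then have "e i = e j" "sat C e d (instP i \<phi>)" by auto
  then show ?case unfolding sat_instP by simp
next
  case (EqSE m n \<Gamma> i j \<phi>)
  then have "d i = d j" "sat C e d (instS i \<phi>)" by auto
  then show ?case unfolding sat_instS by simp
qed auto

text \<open>One assignment suffices for both structures: points are chosen in C and pushed forward
  by f, states are chosen in D and pulled back by g. An existential point of C therefore supplies
  one of D, and a universal statement over states of C applies to the image of any state of D. The
  two equality cases hold because f and g are functions.\<close>

lemma flow_preserved:
  assumes "dense_chu_transform C D f g"
  shows "flow \<theta> \<Longrightarrow> wfn P S \<theta> \<Longrightarrow> e ` P \<subseteq> points C \<Longrightarrow> d ` S \<subseteq> states D \<Longrightarrow>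
    sat C e (g \<circ> d) \<theta> \<Longrightarrow> sat D (f \<circ> e) d \<theta>"
proof (induction arbitrary: e d P S rule: flow.induct)
  note chu = assms[unfolded dense_chu_transform_def chu_transform_def]
  {
    case (3 i j)
    then have "e i \<in> points C" "d j \<in> states D" by auto
    then show ?case using chu 3 by simp
  next
    case (4 i j)
    then have "e i \<in> points C" "d j \<in> states D" by auto
    then show ?case using chu 4 by simp
  next
    \<comment> \<open>Contraposed density: a point of D incident with the state would give a point
      of C incident with its image under g.\<close>
    case (5 j)
    then have "d j \<in> states D" by auto
    then show ?case using chu 5 by (auto simp: image_subset_iff)
  next
    case (10 \<theta>)
    obtain x where x: "x \<in> points C" "sat C (case_nat x e) (g \<circ> d) \<theta>"
      using "10.prems"(4) by (auto simp: comp_def)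
    have "sat D (f \<circ> case_nat x e) d \<theta>"
    proof (rule "10.IH"[of "up P" S])
      show "case_nat x e ` up P \<subseteq> points C" using "10.prems"(2) x(1) by auto
      show "wfn (up P) S \<theta>" using "10.prems"(1) by simp
    qed (rule "10.prems"(3) x(2))+
    moreover have "f \<circ> case_nat x e = case_nat (f x) (f \<circ> e)"
      by (auto simp: fun_eq_iff split: nat.splits)
    ultimately show ?case using chu x by (auto simp: comp_def)
  next
    case (11 \<theta>)
    have "sat D (f \<circ> e) (case_nat b d) \<theta>" if b: "b \<in> states D" for b
    proof (rule "11.IH"[of P "up S"])
      have "g \<circ> case_nat b d = case_nat (g b) (g \<circ> d)"
        by (auto simp: fun_eq_iff split: nat.splits)
      then show "sat C e (g \<circ> case_nat b d) \<theta>"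
        using "11.prems"(4) chu b by (auto simp: comp_def)
    qed (use 11 b in auto)
    then show ?case by (simp add: comp_def)
  }
qed auto

section \<open>Henkin theories and their term models\<close>

text \<open>Closure is asked for derivations from finitely many hypotheses over finitely many names.
  The data of such a derivation all occur at a single stage of a chain, so the union of a chain
  qualifies without a compactness theorem for \<open>nderiv\<close>.\<close>

locale henkin =
  fixes P S :: "nat set" and H :: "fm set"
  assumes wf: "\<chi> \<in> H \<Longrightarrow> wfn P S \<chi>"
    and closed: "finite F \<Longrightarrow> F \<subseteq> H \<Longrightarrow> finite P' \<Longrightarrow> P' \<subseteq> P \<Longrightarrow> finite S' \<Longrightarrow> S' \<subseteq> S \<Longrightarrow>
      nderiv P' S' F \<chi> \<Longrightarrow> \<chi> \<in> H"
    and consistent: "Bot \<notin> H"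
    and complete: "wfn P S \<chi> \<Longrightarrow> \<chi> \<in> H \<or> Neg \<chi> \<in> H"
    and witnessP: "Neg (AllP \<chi>) \<in> H \<Longrightarrow> \<exists>c\<in>P. Neg (instP c \<chi>) \<in> H"
    and witnessS: "Neg (AllS \<chi>) \<in> H \<Longrightarrow> \<exists>c\<in>S. Neg (instS c \<chi>) \<in> H"
begin

text \<open>The finite context is taken to be the names that occur in the formulas. Instantiation
  and substitution may involve further names; for these \<open>closed\<close> is applied directly
  with a larger context.\<close>

lemma closed_fv:
  assumes "finite F" "F \<subseteq> H" "nderiv (fvP \<chi> \<union> \<Union> (fvP ` F)) (fvS \<chi> \<union> \<Union> (fvS ` F)) F \<chi>" "wfn P S \<chi>"
  shows "\<chi> \<in> H"
  by (rule closed[OF assms(1,2) _ _ _ _ assms(3)])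
    (use assms wf in \<open>auto simp: wfn_def finite_fvP finite_fvS\<close>)

lemma Neg_mem_iff:
  assumes "wfn P S \<chi>"
  shows "Neg \<chi> \<in> H \<longleftrightarrow> \<chi> \<notin> H"
proof -
  have "Bot \<in> H" if "Neg \<chi> \<in> H" "\<chi> \<in> H"
    by (rule closed_fv[of "{Neg \<chi>, \<chi>}"])
      (use that in \<open>auto intro!: nderiv_NegE[OF _ nderiv.Assm, of \<chi>] simp: wfn_def\<close>)
  then show ?thesis using complete[OF assms] consistent by blast
qed

lemma Imp_mem_iff:
  assumes "wfn P S \<phi>" "wfn P S \<psi>"
  shows "Imp \<phi> \<psi> \<in> H \<longleftrightarrow> (\<phi> \<in> H \<longrightarrow> \<psi> \<in> H)"
proof -
  have "\<psi> \<in> H" if "Imp \<phi> \<psi> \<in> H" "\<phi> \<in> H"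
    by (rule closed_fv[of "{Imp \<phi> \<psi>, \<phi>}"])
      (use that assms in \<open>auto intro!: nderiv.ImpE[OF nderiv.Assm nderiv.Assm, of \<phi> \<psi>] simp: wfn_def\<close>)
  moreover have "Imp \<phi> \<psi> \<in> H" if "\<psi> \<in> H"
    by (rule closed_fv[of "{\<psi>}"])
      (use that assms in \<open>simp_all add: nderiv.ImpI nderiv.Assm wfn_def\<close>)
  moreover have "Imp \<phi> \<psi> \<in> H" if "Neg \<phi> \<in> H"
    by (rule closed_fv[of "{Neg \<phi>}"])
      (use that assms in \<open>auto intro!: nderiv.ImpI nderiv_BotE[OF nderiv_NegE[OF _ nderiv_self]]
        simp: wfn_def\<close>)
  ultimately show ?thesis using Neg_mem_iff[OF assms(1)] by blast
qed

lemma AllP_mem_iff: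
  assumes "wfn (up P) S \<chi>"
  shows "AllP \<chi> \<in> H \<longleftrightarrow> (\<forall>c\<in>P. instP c \<chi> \<in> H)"
proof -
  have "instP c \<chi> \<in> H" if "AllP \<chi> \<in> H" "c \<in> P" for c
  \<comment> \<open>The name \<open>c\<close> must be added, since \<open>AllPE\<close> instantiates
    only by a name of the context and \<open>c\<close> may not occur in the quantified
    formula.\<close>
  proof (rule closed[of "{AllP \<chi>}" "insert c (fvP (AllP \<chi>))" "fvS \<chi>"])
    show "nderiv (insert c (fvP (AllP \<chi>))) (fvS \<chi>) {AllP \<chi>} (instP c \<chi>)"
      by (intro nderiv.AllPE nderiv.Assm) (auto simp only: wfn_def fvP.simps fvS.simps)
    show "finite (insert c (fvP (AllP \<chi>)))" using finite_fvP[of "AllP \<chi>"] by simp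
    show "insert c (fvP (AllP \<chi>)) \<subseteq> P" using wf[OF that(1)] that(2) unfolding wfn_def by simp
    show "fvS \<chi> \<subseteq> S" using assms by (simp add: wfn_def)
  qed (use that finite_fvS in auto)
  moreover have "\<exists>c\<in>P. instP c \<chi> \<notin> H" if "AllP \<chi> \<notin> H"
    using that witnessP[of \<chi>] Neg_mem_iff[of "AllP \<chi>"] Neg_mem_iff[OF wfn_instP[OF assms]] assms
    by auto
  ultimately show ?thesis by blast
qed

lemma AllS_mem_iff:
  assumes "wfn P (up S) \<chi>"
  shows "AllS \<chi> \<in> H \<longleftrightarrow> (\<forall>c\<in>S. instS c \<chi> \<in> H)"
proof -
  have "instS c \<chi> \<in> H" if "AllS \<chi> \<in> H" "c \<in> S" for c
  proof (rule closed[of "{AllS \<chi>}" "fvP \<chi>" "insert c (fvS (AllS \<chi>))"])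
    show "nderiv (fvP \<chi>) (insert c (fvS (AllS \<chi>))) {AllS \<chi>} (instS c \<chi>)"
      by (intro nderiv.AllSE nderiv.Assm) (auto simp only: wfn_def fvP.simps fvS.simps)
    show "finite (insert c (fvS (AllS \<chi>)))" using finite_fvS[of "AllS \<chi>"] by simp
    show "insert c (fvS (AllS \<chi>)) \<subseteq> S" using wf[OF that(1)] that(2) unfolding wfn_def by simp
    show "fvP \<chi> \<subseteq> P" using assms by (simp add: wfn_def)
  qed (use that finite_fvP in auto)
  moreover have "\<exists>c\<in>S. instS c \<chi> \<notin> H" if "AllS \<chi> \<notin> H"
    using that witnessS[of \<chi>] Neg_mem_iff[of "AllS \<chi>"] Neg_mem_iff[OF wfn_instS[OF assms]] assms
    by auto
  ultimately show ?thesis by blast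
qed

section \<open>Provable equality as a congruence on names\<close>

lemma EqP_refl: "i \<in> P \<Longrightarrow> EqP i i \<in> H"
  by (rule closed_fv[of "{}"]) (auto intro: nderiv.EqPI)

lemma EqS_refl: "i \<in> S \<Longrightarrow> EqS i i \<in> H"
  by (rule closed_fv[of "{}"]) (auto intro: nderiv.EqSI)

lemma EqP_subst:
  assumes "EqP i j \<in> H" "instP i \<chi> \<in> H" "wfn (up P) S \<chi>"
  shows "instP j \<chi> \<in> H"
proof (rule closed[of "{EqP i j, instP i \<chi>}" "insert i (insert j (fvP (AllP \<chi>)))" "fvS \<chi>"])
  show "nderiv (insert i (insert j (fvP (AllP \<chi>)))) (fvS \<chi>) {EqP i j, instP i \<chi>} (instP j \<chi>)"
  proof (rule nderiv.EqPE)
    show wf: "wfn (up (insert i (insert j (fvP (AllP \<chi>))))) (fvS \<chi>) \<chi>"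
      unfolding wfn_def subset_up_iff by auto
    show "nderiv (insert i (insert j (fvP (AllP \<chi>)))) (fvS \<chi>) {EqP i j, instP i \<chi>} (instP i \<chi>)"
      by (intro nderiv.Assm wfn_instP[OF wf]) auto
  qed (auto intro: nderiv.Assm)
  show "finite (insert i (insert j (fvP (AllP \<chi>))))" using finite_fvP[of "AllP \<chi>"] by simp
  have "wfn P S (AllP \<chi>)" using assms(3) by simp
  then show "insert i (insert j (fvP (AllP \<chi>))) \<subseteq> P" "fvS \<chi> \<subseteq> S"
    using wf[OF assms(1)] by (simp_all only: wfn_def) auto
qed (use assms finite_fvS in auto)

lemma EqS_subst:
  assumes "EqS i j \<in> H" "instS i \<chi> \<in> H" "wfn P (up S) \<chi>"
  shows "instS j \<chi> \<in> H"
proof (rule closed[of "{EqS i j, instS i \<chi>}" "fvP \<chi>" "insert i (insert j (fvS (AllS \<chi>)))"])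
  show "nderiv (fvP \<chi>) (insert i (insert j (fvS (AllS \<chi>)))) {EqS i j, instS i \<chi>} (instS j \<chi>)"
  proof (rule nderiv.EqSE)
    show wf: "wfn (fvP \<chi>) (up (insert i (insert j (fvS (AllS \<chi>))))) \<chi>"
      unfolding wfn_def subset_up_iff by auto
    show "nderiv (fvP \<chi>) (insert i (insert j (fvS (AllS \<chi>)))) {EqS i j, instS i \<chi>} (instS i \<chi>)"
      by (intro nderiv.Assm wfn_instS[OF wf]) auto
  qed (auto intro: nderiv.Assm)
  show "finite (insert i (insert j (fvS (AllS \<chi>))))" using finite_fvS[of "AllS \<chi>"] by simp
  have "wfn P S (AllS \<chi>)" using assms(3) by simp
  then show "insert i (insert j (fvS (AllS \<chi>))) \<subseteq> S" "fvP \<chi> \<subseteq> P"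
    using wf[OF assms(1)] by (simp_all only: wfn_def) auto
qed (use assms finite_fvP in auto)

text \<open>In the substituted formula, 0 marks the place to rewrite and the parameter i appears as
  \<open>Suc i\<close>, because instantiation lowers it again. The next lemmas use the same
  device.\<close>

lemma EqP_sym: "EqP i j \<in> H \<Longrightarrow> EqP j i \<in> H"
  using EqP_subst[of i j "EqP 0 (Suc i)"] EqP_refl[of i] wf[of "EqP i j"] by auto

lemma EqS_sym: "EqS i j \<in> H \<Longrightarrow> EqS j i \<in> H"
  using EqS_subst[of i j "EqS 0 (Suc i)"] EqS_refl[of i] wf[of "EqS i j"] by auto

lemma EqP_trans: "EqP i j \<in> H \<Longrightarrow> EqP j k \<in> H \<Longrightarrow> EqP i k \<in> H"
  using EqP_subst[of j k "EqP (Suc i) 0"] wf[of "EqP i j"] by auto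

lemma EqS_trans: "EqS i j \<in> H \<Longrightarrow> EqS j k \<in> H \<Longrightarrow> EqS i k \<in> H"
  using EqS_subst[of j k "EqS (Suc i) 0"] wf[of "EqS i j"] by auto

lemma Rel_cong: "Rel i j \<in> H \<Longrightarrow> EqP i i' \<in> H \<Longrightarrow> EqS j j' \<in> H \<Longrightarrow> Rel i' j' \<in> H"
  using EqP_subst[of i i' "Rel 0 j"] EqS_subst[of j j' "Rel i' 0"] wf[of "Rel i j"] wf[of "EqP i i'"]
  by auto

end

text \<open>Each class is represented by its least member, and an injection of the naturals carries
  these representatives into the infinite type. This realizes a quotient of names at a carrier type
  fixed in advance.\<close>

lemma quotient_embedding:
  fixes X :: "nat set"
  assumes "infinite (UNIV :: 'a set)"
    and refl: "\<And>i. i \<in> X \<Longrightarrow> E i i" and sym: "\<And>i j. E i j \<Longrightarrow> E j i"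
    and trans: "\<And>i j k. E i j \<Longrightarrow> E j k \<Longrightarrow> E i k"
  obtains q :: "nat \<Rightarrow> 'a" where "\<And>i j. i \<in> X \<Longrightarrow> j \<in> X \<Longrightarrow> q i = q j \<longleftrightarrow> E i j"
proof -
  obtain \<iota> :: "nat \<Rightarrow> 'a" where inj: "inj \<iota>"
    using infinite_countable_subset[OF assms(1)] by blast
  have "\<iota> (LEAST k. E i k) = \<iota> (LEAST k. E j k) \<longleftrightarrow> E i j" if "i \<in> X" "j \<in> X" for i j
  proof
    assume "\<iota> (LEAST k. E i k) = \<iota> (LEAST k. E j k)"
    then have eq: "(LEAST k. E i k) = (LEAST k. E j k)" using inj by (simp add: inj_eq)
    have "E i (LEAST k. E i k)" "E j (LEAST k. E j k)" using that refl by (metis LeastI)+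
    then show "E i j" using eq sym trans by metis
  next
    assume "E i j"
    then have "E i = E j" using sym trans by (intro ext) blast
    then show "\<iota> (LEAST k. E i k) = \<iota> (LEAST k. E j k)" by simp
  qed
  then show thesis by (intro that[of "\<lambda>i. \<iota> (LEAST k. E i k)"])
qed

text \<open>The naming maps q and r double as assignments: a free variable of a formula in H is
  itself a name, and it denotes its class.\<close>

lemma (in henkin) term_model:
  assumes "infinite (UNIV :: 'p set)" "infinite (UNIV :: 's set)"
  obtains C :: "('p, 's) chu" and q r where
    "chu_space C" "points C = q ` P" "states C = r ` S"
    "\<And>\<phi>. wfn P S \<phi> \<Longrightarrow> sat C q r \<phi> \<longleftrightarrow> \<phi> \<in> H"
proof -
  obtain q :: "nat \<Rightarrow> 'p" where q: "\<And>i j. i \<in> P \<Longrightarrow> j \<in> P \<Longrightarrow> q i = q j \<longleftrightarrow> EqP i j \<in> H"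
    by (rule quotient_embedding[OF assms(1), of P "\<lambda>i j. EqP i j \<in> H"])
      (auto intro: EqP_refl EqP_sym EqP_trans)
  obtain r :: "nat \<Rightarrow> 's" where r: "\<And>i j. i \<in> S \<Longrightarrow> j \<in> S \<Longrightarrow> r i = r j \<longleftrightarrow> EqS i j \<in> H"
    by (rule quotient_embedding[OF assms(2), of S "\<lambda>i j. EqS i j \<in> H"])
      (auto intro: EqS_refl EqS_sym EqS_trans)
  define C where "C = \<lparr>points = q ` P, inc = {(q i, r j) | i j. Rel i j \<in> H}, states = r ` S\<rparr>"
  have inc: "(q i, r j) \<in> inc C \<longleftrightarrow> Rel i j \<in> H" if "i \<in> P" "j \<in> S" for i j
  proof
    assume "(q i, r j) \<in> inc C"
    then obtain i' j' where eq: "q i = q i'" "r j = r j'" and rel: "Rel i' j' \<in> H"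
      by (auto simp: C_def)
    have "i' \<in> P" "j' \<in> S" using wf[OF rel] by auto
    then show "Rel i j \<in> H" using Rel_cong[OF rel] eq q r that by metis
  qed (auto simp: C_def)
  \<comment> \<open>An instance of a quantified body is not a subformula, so the induction treats
    all renamings at once; the instance at \<open>c\<close> is the renaming
    \<open>case_nat c \<rho>\<close> of the body.\<close>
  have truth: "sat C (q \<circ> \<rho>) (r \<circ> \<pi>) \<phi> \<longleftrightarrow> ren \<rho> \<pi> \<phi> \<in> H"
    if "\<rho> ` fvP \<phi> \<subseteq> P" "\<pi> ` fvS \<phi> \<subseteq> S" for \<rho> \<pi> \<phi>
    using that
  proof (induction \<phi> arbitrary: \<rho> \<pi>)
    case Bot
    then show ?case using consistent by simp
  next
    case (EqP i j)
    then show ?case using q by simp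
  next
    case (EqS i j)
    then show ?case using r by simp
  next
    case (Rel i j)
    then show ?case using inc by simp
  next
    case (Imp \<phi> \<psi>)
    then have "wfn P S (ren \<rho> \<pi> \<phi>)" "wfn P S (ren \<rho> \<pi> \<psi>)" by (auto simp: wfn_def)
    then show ?case using Imp Imp_mem_iff by (simp add: image_Un)
  next
    case (AllP \<phi>)
    have "wfn P S (ren \<rho> \<pi> (AllP \<phi>))" using AllP.prems unfolding wfn_def fvP_ren fvS_ren by simp
    then have wfn: "wfn (up P) S (ren (case_nat 0 (Suc \<circ> \<rho>)) \<pi> \<phi>)" by simp
    have "sat C (case_nat (q c) (q \<circ> \<rho>)) (r \<circ> \<pi>) \<phi> \<longleftrightarrow>
        instP c (ren (case_nat 0 (Suc \<circ> \<rho>)) \<pi> \<phi>) \<in> H" if "c \<in> P" for c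
    proof -
      have "sat C (q \<circ> case_nat c \<rho>) (r \<circ> \<pi>) \<phi> \<longleftrightarrow> ren (case_nat c \<rho>) \<pi> \<phi> \<in> H"
        using AllP.prems that by (intro AllP.IH) (auto simp: image_subset_iff split: nat.splits)
      moreover have "q \<circ> case_nat c \<rho> = case_nat (q c) (q \<circ> \<rho>)"
        by (auto simp: fun_eq_iff split: nat.splits)
      ultimately show ?thesis by (simp add: ren_ren case_nat_comp_lift)
    qed
    then show ?case using AllP_mem_iff[OF wfn] by (simp add: C_def comp_def)
  next
    case (AllS \<phi>)
    have "wfn P S (ren \<rho> \<pi> (AllS \<phi>))" using AllS.prems unfolding wfn_def fvP_ren fvS_ren by simp
    then have wfn: "wfn P (up S) (ren \<rho> (case_nat 0 (Suc \<circ> \<pi>)) \<phi>)" by simp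
    have "sat C (q \<circ> \<rho>) (case_nat (r c) (r \<circ> \<pi>)) \<phi> \<longleftrightarrow>
        instS c (ren \<rho> (case_nat 0 (Suc \<circ> \<pi>)) \<phi>) \<in> H" if "c \<in> S" for c
    proof -
      have "sat C (q \<circ> \<rho>) (r \<circ> case_nat c \<pi>) \<phi> \<longleftrightarrow> ren \<rho> (case_nat c \<pi>) \<phi> \<in> H"
        using AllS.prems that by (intro AllS.IH) (auto simp: image_subset_iff split: nat.splits)
      moreover have "r \<circ> case_nat c \<pi> = case_nat (r c) (r \<circ> \<pi>)"
        by (auto simp: fun_eq_iff split: nat.splits)
      ultimately show ?thesis by (simp add: ren_ren case_nat_comp_lift)
    qed
    then show ?case using AllS_mem_iff[OF wfn] by (simp add: C_def comp_def)
  qed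
  show thesis
  proof (rule that[of C q r])
    show "chu_space C" using wf by (fastforce simp: chu_space_def C_def)
    show "sat C q r \<phi> \<longleftrightarrow> \<phi> \<in> H" if "wfn P S \<phi>" for \<phi>
      using truth[of id \<phi> id] that by (simp add: wfn_def)
  qed (simp_all add: C_def)
qed

section \<open>Unions of chains of theories\<close>

lemma finite_subset_chain:
  fixes X :: "nat \<Rightarrow> 'a set"
  assumes "finite F" "F \<subseteq> (\<Union>i. X i)" "mono X"
  shows "\<exists>k. F \<subseteq> X k"
  using assms(1,2)
proof (induction F)
  case (insert x F)
  then obtain k l where "F \<subseteq> X k" "x \<in> X l" by auto
  then have "insert x F \<subseteq> X (max k l)"
    using monoD[OF assms(3), of k "max k l"] monoD[OF assms(3), of l "max k l"] by auto
  then show ?case by blast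
qed auto

text \<open>Decisions and witnesses may arrive at a later stage than the formula they concern.
  Deductive closure is not assumed of the stages: it follows from decisions and consistency, since
  refuting a derivable formula would make some later stage inconsistent.\<close>

lemma henkin_limit:
  fixes Ps Ss :: "nat \<Rightarrow> nat set" and Hs :: "nat \<Rightarrow> fm set"
  assumes mono: "mono Ps" "mono Ss" "mono Hs"
    and wf: "\<And>i \<chi>. \<chi> \<in> Hs i \<Longrightarrow> wfn (Ps i) (Ss i) \<chi>"
    and cons: "\<And>i. \<not> nderiv (Ps i) (Ss i) (Hs i) Bot"
    and dec: "\<And>i \<chi>. wfn (Ps i) (Ss i) \<chi> \<Longrightarrow> \<exists>j. \<chi> \<in> Hs j \<or> Neg \<chi> \<in> Hs j"
    and witP: "\<And>i \<chi>. Neg (AllP \<chi>) \<in> Hs i \<Longrightarrow> \<exists>j. \<exists>c\<in>Ps j. Neg (instP c \<chi>) \<in> Hs j"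
    and witS: "\<And>i \<chi>. Neg (AllS \<chi>) \<in> Hs i \<Longrightarrow> \<exists>j. \<exists>c\<in>Ss j. Neg (instS c \<chi>) \<in> Hs j"
  shows "henkin (\<Union>i. Ps i) (\<Union>i. Ss i) (\<Union>i. Hs i)"
proof
  note le = mono[THEN monoD]
  have sub: "\<exists>k. A \<subseteq> Ps k \<and> B \<subseteq> Ss k \<and> F \<subseteq> Hs k"
    if prems: "finite A" "A \<subseteq> (\<Union>i. Ps i)" "finite B" "B \<subseteq> (\<Union>i. Ss i)" "finite F" "F \<subseteq> (\<Union>i. Hs i)" for A B F
  proof -
    obtain a b c where *: "A \<subseteq> Ps a" "B \<subseteq> Ss b" "F \<subseteq> Hs c"
      using finite_subset_chain[OF prems(1,2) mono(1)] finite_subset_chain[OF prems(3,4) mono(2)]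
        finite_subset_chain[OF prems(5,6) mono(3)] by blast
    define k where "k = max a (max b c)"
    have "a \<le> k" "b \<le> k" "c \<le> k" by (auto simp: k_def)
    then have "Ps a \<subseteq> Ps k" "Ss b \<subseteq> Ss k" "Hs c \<subseteq> Hs k" by (simp_all add: le)
    then show ?thesis using * by blast
  qed
  show "\<chi> \<in> (\<Union>i. Hs i) \<or> Neg \<chi> \<in> (\<Union>i. Hs i)" if wfn: "wfn (\<Union>i. Ps i) (\<Union>i. Ss i) \<chi>" for \<chi>
  proof -
    obtain k where "fvP \<chi> \<subseteq> Ps k \<and> fvS \<chi> \<subseteq> Ss k"
      using sub[OF finite_fvP[of \<chi>] _ finite_fvS[of \<chi>] _ finite.emptyI] wfn
      unfolding wfn_def by auto
    then show ?thesis using dec[of k \<chi>] unfolding wfn_def by blast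
  qed
  show "\<chi> \<in> (\<Union>i. Hs i)" if prems: "finite F" "F \<subseteq> (\<Union>i. Hs i)" "finite P'" "P' \<subseteq> (\<Union>i. Ps i)"
    "finite S'" "S' \<subseteq> (\<Union>i. Ss i)" "nderiv P' S' F \<chi>" for F P' S' \<chi>
  proof -
    obtain k where k: "P' \<subseteq> Ps k" "S' \<subseteq> Ss k" "F \<subseteq> Hs k"
      using sub[OF prems(3,4,5,6,1,2)] by blast
    have "wfn (Ps k) (Ss k) \<chi>" using nderiv_wfn[OF prems(7)] k by (blast intro: wfn_mono)
    then obtain j where j: "\<chi> \<in> Hs j \<or> Neg \<chi> \<in> Hs j" using dec by blast
    have "Neg \<chi> \<notin> Hs j"
    proof
      assume "Neg \<chi> \<in> Hs j"
      then have "Neg \<chi> \<in> Hs (max j k)" using le(3)[of j "max j k"] by auto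
      moreover have "nderiv (Ps (max j k)) (Ss (max j k)) (Hs (max j k)) \<chi>"
        by (rule nderiv_mono[OF prems(7)])
          (use k le[of k "max j k"] in auto)
      ultimately show False using cons nderiv_NegE by blast
    qed
    then show ?thesis using j by blast
  qed
  show "Bot \<notin> (\<Union>i. Hs i)" using cons nderiv.Assm[of Bot] by fastforce
  show "wfn (\<Union>i. Ps i) (\<Union>i. Ss i) \<chi>" if "\<chi> \<in> (\<Union>i. Hs i)" for \<chi>
    using that wf by (auto intro: wfn_mono)
  show "\<exists>c\<in>(\<Union>i. Ps i). Neg (instP c \<chi>) \<in> (\<Union>i. Hs i)" if "Neg (AllP \<chi>) \<in> (\<Union>i. Hs i)" for \<chi>
    using that witP by blast
  show "\<exists>c\<in>(\<Union>i. Ss i). Neg (instS c \<chi>) \<in> (\<Union>i. Hs i)" if "Neg (AllS \<chi>) \<in> (\<Union>i. Hs i)" for \<chi>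
    using that witS by blast
qed

section \<open>Inseparable pairs\<close>

text \<open>\<open>\<Gamma>\<close> is about the source of a Chu transform, with points named in \<open>P\<close> and states named in \<open>A\<close>;
  \<open>\<Delta>\<close> is about its target, with points named in \<open>Q\<close> and states named in \<open>B\<close>. Points travel
  forwards and states backwards, so that \<open>P \<subseteq> Q\<close> and \<open>B \<subseteq> A\<close>.\<close>

definition inseparable ::
    "nat set \<Rightarrow> nat set \<Rightarrow> fm set \<Rightarrow> nat set \<Rightarrow> nat set \<Rightarrow> fm set \<Rightarrow> bool" where
  "inseparable P A \<Gamma> Q B \<Delta> \<longleftrightarrow>
     \<not> (\<exists>\<theta>. flow \<theta> \<and> wfn P B \<theta> \<and> nderiv P A \<Gamma> \<theta> \<and> nderiv Q B \<Delta> (Neg \<theta>))"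

lemma flow_ren: "flow \<theta> \<Longrightarrow> flow (ren \<rho> \<pi> \<theta>)"
  by (induction arbitrary: \<rho> \<pi> rule: flow.induct) (auto intro: flow.intros)

text \<open>An inconsistent source theory would be separated by \<open>Bot\<close>, an inconsistent
  target theory by \<open>Top\<close>.\<close>

lemma inseparable_not_Bot:
  assumes "inseparable P A \<Gamma> Q B \<Delta>"
  shows "\<not> nderiv P A \<Gamma> Bot" "\<not> nderiv Q B \<Delta> Bot"
proof -
  have top: "nderiv X Y \<Theta> Top" for X Y \<Theta> by (simp add: nderiv.ImpI nderiv_self)
  then show "\<not> nderiv P A \<Gamma> Bot"
    using assms flow.intros(8) unfolding inseparable_def by (metis wfn_simps(1))
  have "nderiv Q B \<Delta> (Neg Top)" if "nderiv Q B \<Delta> Bot"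
    using that by (simp add: nderiv_BotE)
  then show "\<not> nderiv Q B \<Delta> Bot"
    using assms top flow.intros(6) unfolding inseparable_def by (metis wfn_simps(1,5))
qed

text \<open>If each of the two extensions has a separator, the source proves the disjunction by
  cases, while the target refutes both disjuncts.\<close>

lemma inseparable_decideL:
  assumes "inseparable P A \<Gamma> Q B \<Delta>" "wfn P A \<chi>"
  shows "inseparable P A (insert \<chi> \<Gamma>) Q B \<Delta> \<or> inseparable P A (insert (Neg \<chi>) \<Gamma>) Q B \<Delta>"
proof (rule ccontr)
  assume "\<not> ?thesis"
  then obtain \<theta>\<^sub>1 \<theta>\<^sub>2 where
    1: "flow \<theta>\<^sub>1" "wfn P B \<theta>\<^sub>1" "nderiv P A (insert \<chi> \<Gamma>) \<theta>\<^sub>1" "nderiv Q B \<Delta> (Neg \<theta>\<^sub>1)" and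
    2: "flow \<theta>\<^sub>2" "wfn P B \<theta>\<^sub>2" "nderiv P A (insert (Neg \<chi>) \<Gamma>) \<theta>\<^sub>2" "nderiv Q B \<Delta> (Neg \<theta>\<^sub>2)"
    unfolding inseparable_def by auto
  have "nderiv P A \<Gamma> (Or \<theta>\<^sub>1 \<theta>\<^sub>2)"
    using nderiv_OrI1[OF 1(3) nderiv_wfn[OF 2(3)]] nderiv_OrI2[OF 2(3) nderiv_wfn[OF 1(3)]] assms(2)
    by (rule nderiv_cases)
  moreover have "nderiv Q B \<Delta> (Neg (Or \<theta>\<^sub>1 \<theta>\<^sub>2))" using 1(4) 2(4) by (rule nderiv_NotOrI)
  moreover have "flow (Or \<theta>\<^sub>1 \<theta>\<^sub>2)" using 1(1) 2(1) by (rule flow.intros)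
  moreover have "wfn P B (Or \<theta>\<^sub>1 \<theta>\<^sub>2)" using 1(2) 2(2) by simp
  ultimately show False using assms(1) unfolding inseparable_def by blast
qed

text \<open>Dually, the source proves both separators and the target, in either case, refutes one
  conjunct.\<close>

lemma inseparable_decideR:
  assumes "inseparable P A \<Gamma> Q B \<Delta>" "wfn Q B \<chi>"
  shows "inseparable P A \<Gamma> Q B (insert \<chi> \<Delta>) \<or> inseparable P A \<Gamma> Q B (insert (Neg \<chi>) \<Delta>)"
proof (rule ccontr)
  assume "\<not> ?thesis"
  then obtain \<theta>\<^sub>1 \<theta>\<^sub>2 where
    1: "flow \<theta>\<^sub>1" "wfn P B \<theta>\<^sub>1" "nderiv P A \<Gamma> \<theta>\<^sub>1" "nderiv Q B (insert \<chi> \<Delta>) (Neg \<theta>\<^sub>1)" and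
    2: "flow \<theta>\<^sub>2" "wfn P B \<theta>\<^sub>2" "nderiv P A \<Gamma> \<theta>\<^sub>2" "nderiv Q B (insert (Neg \<chi>) \<Delta>) (Neg \<theta>\<^sub>2)"
    unfolding inseparable_def by auto
  have wf: "wfn Q B \<theta>\<^sub>1" "wfn Q B \<theta>\<^sub>2" using nderiv_wfn[OF 1(4)] nderiv_wfn[OF 2(4)] by simp_all
  have "nderiv Q B \<Delta> (Neg (And \<theta>\<^sub>1 \<theta>\<^sub>2))"
    using nderiv_NotAndI1[OF 1(4) wf(2)] nderiv_NotAndI2[OF 2(4) wf(1)] assms(2)
    by (rule nderiv_cases)
  moreover have "nderiv P A \<Gamma> (And \<theta>\<^sub>1 \<theta>\<^sub>2)" using 1(3) 2(3) by (rule nderiv_AndI)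
  moreover have "flow (And \<theta>\<^sub>1 \<theta>\<^sub>2)" using 1(1) 2(1) by (rule flow.intros)
  moreover have "wfn P B (And \<theta>\<^sub>1 \<theta>\<^sub>2)" using 1(2) 2(2) by simp
  ultimately show False using assms(1) unfolding inseparable_def by blast
qed

section \<open>Witnesses preserve inseparability\<close>

lemma wfn_absvP: "wfn (insert c P) S \<theta> \<Longrightarrow> wfn (up P) S (ren (absv c) id \<theta>)"
  by (erule wfn_ren) (auto simp: absv_def)

lemma wfn_absvS: "wfn P (insert c S) \<theta> \<Longrightarrow> wfn P (up S) (ren id (absv c) \<theta>)"
  by (erule wfn_ren) (auto simp: absv_def)

text \<open>A separator may mention the new shared point \<open>c\<close>. Binding it by \<exists>
  keeps it provable in the source, where \<open>c\<close> was a conservative witness. In the target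
  nothing is assumed about \<open>c\<close>, so the refutation generalizes to every point.\<close>

lemma inseparable_witnessLP:
  assumes "inseparable P A \<Gamma> Q B \<Delta>" "Neg (AllP \<chi>) \<in> \<Gamma>" "c \<notin> Q" "P \<subseteq> Q"
    and "\<forall>\<gamma>\<in>\<Gamma>. wfn P A \<gamma>" "\<forall>\<delta>\<in>\<Delta>. wfn Q B \<delta>"
  shows "inseparable (insert c P) A (insert (Neg (instP c \<chi>)) \<Gamma>) (insert c Q) B \<Delta>"
  unfolding inseparable_def
proof (rule notI, elim exE conjE)
  fix \<theta> assume \<theta>: "flow \<theta>" "wfn (insert c P) B \<theta>"
    "nderiv (insert c P) A (insert (Neg (instP c \<chi>)) \<Gamma>) \<theta>" "nderiv (insert c Q) B \<Delta> (Neg \<theta>)"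
  define \<theta>' where "\<theta>' = ren (absv c) id \<theta>"
  have inst: "instP c \<theta>' = \<theta>" by (simp add: \<theta>'_def instP_absv)
  have wfL: "wfn (up P) A \<theta>'" using wfn_absvP[OF nderiv_wfn[OF \<theta>(3)]] by (simp add: \<theta>'_def)
  have wfR: "wfn (up Q) B \<theta>'" using wfn_absvP[of c Q B \<theta>] nderiv_wfn[OF \<theta>(4)] by (simp add: \<theta>'_def)
  have "nderiv P A \<Gamma> (ExP \<theta>')"
  proof (rule nderiv_witnessP[OF assms(2)])
    show "nderiv (insert c P) A (insert (Neg (instP c \<chi>)) \<Gamma>) (ExP \<theta>')"
      by (rule nderiv_ExPI[of _ _ _ c]) (use \<theta>(3) inst wfL in \<open>auto elim!: wfn_mono\<close>)
  qed (use assms wfL in auto)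
  moreover have "nderiv Q B \<Delta> (AllP (Neg \<theta>'))"
    by (rule nderiv_AllP_fresh[of c]) (use assms \<theta>(4) inst wfR in auto)
  \<comment> \<open>By definition the negated existential is the double negation of the universal
    just derived.\<close>
  then have "nderiv Q B \<Delta> (Neg (ExP \<theta>'))" by (rule nderiv_NotNotI)
  moreover have "flow (ExP \<theta>')" unfolding \<theta>'_def by (intro flow.intros(10) flow_ren \<theta>(1))
  moreover have "wfn P B (ExP \<theta>')" using wfn_absvP[OF \<theta>(2)] by (simp add: \<theta>'_def)
  ultimately show False using assms(1) unfolding inseparable_def by blast
qed

text \<open>The new state stays private to the source: separators range over states in B, so
  conservativity of the witness is enough.\<close>

lemma inseparable_witnessLS:
  assumes "inseparable P A \<Gamma> Q B \<Delta>" "Neg (AllS \<chi>) \<in> \<Gamma>" "c \<notin> A" "B \<subseteq> A" "\<forall>\<gamma>\<in>\<Gamma>. wfn P A \<gamma>"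
  shows "inseparable P (insert c A) (insert (Neg (instS c \<chi>)) \<Gamma>) Q B \<Delta>"
  using assms nderiv_witnessS[OF assms(2) _ assms(3,5)] unfolding inseparable_def
  by (meson order_refl wfn_mono)

lemma inseparable_witnessRP:
  assumes "inseparable P A \<Gamma> Q B \<Delta>" "Neg (AllP \<chi>) \<in> \<Delta>" "c \<notin> Q" "P \<subseteq> Q" "\<forall>\<delta>\<in>\<Delta>. wfn Q B \<delta>"
  shows "inseparable P A \<Gamma> (insert c Q) B (insert (Neg (instP c \<chi>)) \<Delta>)"
proof -
  have "wfn Q B (Neg \<theta>)" if "wfn P B \<theta>" for \<theta>
    using wfn_mono[OF that assms(4) order_refl] by simp
  then show ?thesis
    using assms(1) nderiv_witnessP[OF assms(2) _ assms(3,5)] unfolding inseparable_def by blast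
qed

text \<open>The mirror image of a source point witness: the source knows nothing about the new state
  and generalizes over it, while the target instantiates the universal formula at its witness and
  refutes it there.\<close>

lemma inseparable_witnessRS:
  assumes "inseparable P A \<Gamma> Q B \<Delta>" "Neg (AllS \<chi>) \<in> \<Delta>" "c \<notin> A" "B \<subseteq> A"
    and "\<forall>\<gamma>\<in>\<Gamma>. wfn P A \<gamma>" "\<forall>\<delta>\<in>\<Delta>. wfn Q B \<delta>"
  shows "inseparable P (insert c A) \<Gamma> Q (insert c B) (insert (Neg (instS c \<chi>)) \<Delta>)"
  unfolding inseparable_def
proof (rule notI, elim exE conjE)
  fix \<theta> assume \<theta>: "flow \<theta>" "wfn P (insert c B) \<theta>"
    "nderiv P (insert c A) \<Gamma> \<theta>" "nderiv Q (insert c B) (insert (Neg (instS c \<chi>)) \<Delta>) (Neg \<theta>)"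
  define \<theta>' where "\<theta>' = ren id (absv c) \<theta>"
  have inst: "instS c \<theta>' = \<theta>" by (simp add: \<theta>'_def instS_absv)
  have wfL: "wfn P (up A) \<theta>'" using wfn_absvS[OF nderiv_wfn[OF \<theta>(3)]] by (simp add: \<theta>'_def)
  have wfR: "wfn Q (up B) \<theta>'" using wfn_absvS[of Q c B \<theta>] nderiv_wfn[OF \<theta>(4)] by (simp add: \<theta>'_def)
  have "nderiv P A \<Gamma> (AllS \<theta>')"
    by (rule nderiv_AllS_fresh[of _ c]) (use assms \<theta>(3) inst wfL in auto)
  moreover have "nderiv Q B \<Delta> (Neg (AllS \<theta>'))"
  proof (rule nderiv_witnessS[OF assms(2)])
    let ?D = "insert (AllS \<theta>') (insert (Neg (instS c \<chi>)) \<Delta>)"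
    have wf: "wfn Q (insert c B) (AllS \<theta>')" using wfR by (auto elim!: wfn_mono)
    have "nderiv Q (insert c B) ?D (instS c \<theta>')"
      by (rule nderiv.AllSE[OF nderiv_self[OF wf]]) simp
    then have "nderiv Q (insert c B) ?D Bot"
      unfolding inst by (rule nderiv.ImpE[OF nderiv_insert[OF \<theta>(4)]])
    then show "nderiv Q (insert c B) (insert (Neg (instS c \<chi>)) \<Delta>) (Neg (AllS \<theta>'))"
      by (rule nderiv.ImpI[OF wf])
  qed (use assms wfR in auto)
  moreover have "flow (AllS \<theta>')" unfolding \<theta>'_def by (intro flow.intros(11) flow_ren \<theta>(1))
  moreover have "wfn P B (AllS \<theta>')" using wfn_absvS[OF \<theta>(2)] by (simp add: \<theta>'_def)
  ultimately show False using assms(1) unfolding inseparable_def by blast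
qed

section \<open>The generic pair\<close>

text \<open>Bookkeeping: stage n serves the task coded in the first component of n. The code of
  \<open>(k, i)\<close> is at least i, so every task recurs after every stage, in particular after
  the formula it concerns has appeared.\<close>

lemma generic_chain:
  fixes R :: "'k::countable \<Rightarrow> 'a \<Rightarrow> 'a \<Rightarrow> bool"
  assumes "G s\<^sub>0" "\<And>k s. G s \<Longrightarrow> \<exists>t. G t \<and> R k s t"
  obtains ch where "ch 0 = s\<^sub>0" "\<And>i. G (ch i)" "\<And>i. \<exists>k. R k (ch i) (ch (Suc i))"
    "\<And>k i. \<exists>j\<ge>i. R k (ch j) (ch (Suc j))"
proof -
  define task :: "nat \<Rightarrow> 'k" where "task n = from_nat (fst (prod_decode n))" for n
  have "\<exists>ch. \<forall>n. (G (ch n) \<and> (n = 0 \<longrightarrow> ch n = s\<^sub>0)) \<and> R (task n) (ch n) (ch (Suc n))"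
    by (rule dependent_nat_choice[of "\<lambda>n s. G s \<and> (n = 0 \<longrightarrow> s = s\<^sub>0)"]) (use assms in auto)
  then obtain ch where ch: "ch 0 = s\<^sub>0" "\<And>n. G (ch n)" "\<And>n. R (task n) (ch n) (ch (Suc n))" by auto
  have "\<exists>j\<ge>i. R k (ch j) (ch (Suc j))" for k i
    using ch(3)[of "prod_encode (to_nat k, i)"] le_prod_encode_2[of i "to_nat k"]
    by (auto simp: task_def)
  then show thesis using that ch by blast
qed

record stage =
  ptsL :: "nat set"
  stsL :: "nat set"
  thyL :: "fm set"
  ptsR :: "nat set"
  stsR :: "nat set"
  thyR :: "fm set"

text \<open>Finiteness of the two larger name sets guarantees fresh names at every stage. The
  theories contain T and may be infinite.\<close>

definition good :: "stage \<Rightarrow> bool" where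
  "good s \<longleftrightarrow> finite (ptsR s) \<and> finite (stsL s) \<and> ptsL s \<subseteq> ptsR s \<and> stsR s \<subseteq> stsL s \<and>
     (\<forall>\<gamma>\<in>thyL s. wfn (ptsL s) (stsL s) \<gamma>) \<and> (\<forall>\<delta>\<in>thyR s. wfn (ptsR s) (stsR s) \<delta>) \<and>
     inseparable (ptsL s) (stsL s) (thyL s) (ptsR s) (stsR s) (thyR s)"

definition extends :: "stage \<Rightarrow> stage \<Rightarrow> bool" where
  "extends s t \<longleftrightarrow> ptsL s \<subseteq> ptsL t \<and> stsL s \<subseteq> stsL t \<and> thyL s \<subseteq> thyL t \<and>
     ptsR s \<subseteq> ptsR t \<and> stsR s \<subseteq> stsR t \<and> thyR s \<subseteq> thyR t"

datatype task = DecL fm | DecR fm | WitLP fm | WitLS fm | WitRP fm | WitRS fm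

instance fm :: countable by countable_datatype

instance task :: countable by countable_datatype

text \<open>The guards refer to the current stage, so a task that does not yet apply is met by
  standing still and gets its chance when it recurs.\<close>

fun meets :: "task \<Rightarrow> stage \<Rightarrow> stage \<Rightarrow> bool" where
  "meets (DecL \<chi>) s t \<longleftrightarrow> (wfn (ptsL s) (stsL s) \<chi> \<longrightarrow> \<chi> \<in> thyL t \<or> Neg \<chi> \<in> thyL t)"
| "meets (DecR \<chi>) s t \<longleftrightarrow> (wfn (ptsR s) (stsR s) \<chi> \<longrightarrow> \<chi> \<in> thyR t \<or> Neg \<chi> \<in> thyR t)"
| "meets (WitLP \<chi>) s t \<longleftrightarrow> (Neg (AllP \<chi>) \<in> thyL s \<longrightarrow> (\<exists>c\<in>ptsL t. Neg (instP c \<chi>) \<in> thyL t))"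
| "meets (WitLS \<chi>) s t \<longleftrightarrow> (Neg (AllS \<chi>) \<in> thyL s \<longrightarrow> (\<exists>c\<in>stsL t. Neg (instS c \<chi>) \<in> thyL t))"
| "meets (WitRP \<chi>) s t \<longleftrightarrow> (Neg (AllP \<chi>) \<in> thyR s \<longrightarrow> (\<exists>c\<in>ptsR t. Neg (instP c \<chi>) \<in> thyR t))"
| "meets (WitRS \<chi>) s t \<longleftrightarrow> (Neg (AllS \<chi>) \<in> thyR s \<longrightarrow> (\<exists>c\<in>stsR t. Neg (instS c \<chi>) \<in> thyR t))"

lemma wfn_witness:
  assumes "\<forall>\<gamma>\<in>\<Gamma>. wfn P S \<gamma>"
  shows "Neg (AllP \<chi>) \<in> \<Gamma> \<Longrightarrow> \<forall>\<gamma>\<in>insert (Neg (instP c \<chi>)) \<Gamma>. wfn (insert c P) S \<gamma>"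
    and "Neg (AllS \<chi>) \<in> \<Gamma> \<Longrightarrow> \<forall>\<gamma>\<in>insert (Neg (instS c \<chi>)) \<Gamma>. wfn P (insert c S) \<gamma>"
proof -
  have mono: "wfn (insert c P) S \<gamma>" "wfn P (insert c S) \<gamma>" if "\<gamma> \<in> \<Gamma>" for \<gamma>
    using assms that by (auto intro: wfn_mono)
  show "\<forall>\<gamma>\<in>insert (Neg (instP c \<chi>)) \<Gamma>. wfn (insert c P) S \<gamma>" if "Neg (AllP \<chi>) \<in> \<Gamma>"
    using mono wfn_instP[of "insert c P" S \<chi> c] mono(1)[OF that] by simp
  show "\<forall>\<gamma>\<in>insert (Neg (instS c \<chi>)) \<Gamma>. wfn P (insert c S) \<gamma>" if "Neg (AllS \<chi>) \<in> \<Gamma>"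
    using mono wfn_instS[of P "insert c S" \<chi> c] mono(2)[OF that] by simp
qed

lemma wfn_mono_insert:
  "\<forall>\<gamma>\<in>\<Gamma>. wfn P S \<gamma> \<Longrightarrow> \<forall>\<gamma>\<in>\<Gamma>. wfn (insert c P) S \<gamma>"
  "\<forall>\<gamma>\<in>\<Gamma>. wfn P S \<gamma> \<Longrightarrow> \<forall>\<gamma>\<in>\<Gamma>. wfn P (insert c S) \<gamma>"
  by (auto intro: wfn_mono)

lemma good_extension:
  assumes "good s"
  shows "\<exists>t. good t \<and> extends s t \<and> meets k s t"
proof -
  note g = assms[unfolded good_def]
  have insep: "inseparable (ptsL s) (stsL s) (thyL s) (ptsR s) (stsR s) (thyR s)" using g by blast
  \<comment> \<open>The larger set of points is the target's and the larger set of states is the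
    source's, so \<open>c\<close> and d are new to both sides. Hence a private name never becomes
    shared later.\<close>
  obtain c where c: "c \<notin> ptsR s" using g by (meson ex_new_if_finite infinite_UNIV_nat)
  obtain d where d: "d \<notin> stsL s" using g by (meson ex_new_if_finite infinite_UNIV_nat)
  have skip: ?thesis if "meets k s s" using that assms by (auto simp: extends_def)
  show ?thesis
  proof (cases k)
    case (DecL \<chi>)
    show ?thesis
    proof (cases "wfn (ptsL s) (stsL s) \<chi>")
      case True
      then obtain \<chi>' where \<chi>': "\<chi>' = \<chi> \<or> \<chi>' = Neg \<chi>"
        "inseparable (ptsL s) (stsL s) (insert \<chi>' (thyL s)) (ptsR s) (stsR s) (thyR s)"
        using inseparable_decideL[OF insep True] by blast
      then show ?thesis using g True DecL
        by (intro exI[of _ "s\<lparr>thyL := insert \<chi>' (thyL s)\<rparr>"]) (auto simp: good_def extends_def)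
    qed (rule skip, simp add: DecL)
  next
    case (DecR \<chi>)
    show ?thesis
    proof (cases "wfn (ptsR s) (stsR s) \<chi>")
      case True
      then obtain \<chi>' where \<chi>': "\<chi>' = \<chi> \<or> \<chi>' = Neg \<chi>"
        "inseparable (ptsL s) (stsL s) (thyL s) (ptsR s) (stsR s) (insert \<chi>' (thyR s))"
        using inseparable_decideR[OF insep True] by blast
      then show ?thesis using g True DecR
        by (intro exI[of _ "s\<lparr>thyR := insert \<chi>' (thyR s)\<rparr>"]) (auto simp: good_def extends_def)
    qed (rule skip, simp add: DecR)
  next
    case (WitLP \<chi>)
    show ?thesis
    proof (cases "Neg (AllP \<chi>) \<in> thyL s")
      case True
      let ?t = "s\<lparr>ptsL := insert c (ptsL s), thyL := insert (Neg (instP c \<chi>)) (thyL s),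
        ptsR := insert c (ptsR s)\<rparr>"
      have "inseparable (insert c (ptsL s)) (stsL s) (insert (Neg (instP c \<chi>)) (thyL s))
          (insert c (ptsR s)) (stsR s) (thyR s)"
        using g True c by (intro inseparable_witnessLP) auto
      moreover note wfn_witness(1)[OF _ True, of "ptsL s" "stsL s" c]
        wfn_mono_insert(1)[of "thyR s" "ptsR s" "stsR s" c]
      ultimately have "good ?t" using g unfolding good_def by auto
      then show ?thesis using WitLP by (intro exI[of _ ?t]) (auto simp: extends_def)
    qed (rule skip, simp add: WitLP)
  next
    case (WitLS \<chi>)
    show ?thesis
    proof (cases "Neg (AllS \<chi>) \<in> thyL s")
      case True
      let ?t = "s\<lparr>stsL := insert d (stsL s), thyL := insert (Neg (instS d \<chi>)) (thyL s)\<rparr>"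
      have "inseparable (ptsL s) (insert d (stsL s)) (insert (Neg (instS d \<chi>)) (thyL s))
          (ptsR s) (stsR s) (thyR s)"
        using g True d by (intro inseparable_witnessLS) auto
      moreover note wfn_witness(2)[OF _ True, of "ptsL s" "stsL s" d]
      ultimately have "good ?t" using g unfolding good_def by auto
      then show ?thesis using WitLS by (intro exI[of _ ?t]) (auto simp: extends_def)
    qed (rule skip, simp add: WitLS)
  next
    case (WitRP \<chi>)
    show ?thesis
    proof (cases "Neg (AllP \<chi>) \<in> thyR s")
      case True
      let ?t = "s\<lparr>ptsR := insert c (ptsR s), thyR := insert (Neg (instP c \<chi>)) (thyR s)\<rparr>"
      have "inseparable (ptsL s) (stsL s) (thyL s)
          (insert c (ptsR s)) (stsR s) (insert (Neg (instP c \<chi>)) (thyR s))"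
        using g True c by (intro inseparable_witnessRP) auto
      moreover note wfn_witness(1)[OF _ True, of "ptsR s" "stsR s" c]
      ultimately have "good ?t" using g unfolding good_def by auto
      then show ?thesis using WitRP by (intro exI[of _ ?t]) (auto simp: extends_def)
    qed (rule skip, simp add: WitRP)
  next
    case (WitRS \<chi>)
    show ?thesis
    proof (cases "Neg (AllS \<chi>) \<in> thyR s")
      case True
      let ?t = "s\<lparr>stsL := insert d (stsL s), stsR := insert d (stsR s),
        thyR := insert (Neg (instS d \<chi>)) (thyR s)\<rparr>"
      have "inseparable (ptsL s) (insert d (stsL s)) (thyL s)
          (ptsR s) (insert d (stsR s)) (insert (Neg (instS d \<chi>)) (thyR s))"
        using g True d by (intro inseparable_witnessRS) auto
      moreover note wfn_witness(2)[OF _ True, of "ptsR s" "stsR s" d]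
        wfn_mono_insert(2)[of "thyL s" "ptsL s" "stsL s" d]
      ultimately have "good ?t" using g unfolding good_def by auto
      then show ?thesis using WitRS by (intro exI[of _ ?t]) (auto simp: extends_def)
    qed (rule skip, simp add: WitRS)
  qed
qed

lemma generic_pair:
  assumes "good s\<^sub>0"
  obtains P A \<Gamma> Q B \<Delta> where
    "henkin P A \<Gamma>" "henkin Q B \<Delta>" "P \<subseteq> Q" "B \<subseteq> A"
    "ptsL s\<^sub>0 \<subseteq> P" "stsR s\<^sub>0 \<subseteq> B" "thyL s\<^sub>0 \<subseteq> \<Gamma>" "thyR s\<^sub>0 \<subseteq> \<Delta>"
    "\<And>\<theta>. flow \<theta> \<Longrightarrow> wfn P B \<theta> \<Longrightarrow> \<theta> \<in> \<Gamma> \<Longrightarrow> \<theta> \<in> \<Delta>"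
proof -
  obtain ch where ch: "ch 0 = s\<^sub>0" "\<And>i. good (ch i)"
      "\<And>i. \<exists>k. extends (ch i) (ch (Suc i)) \<and> meets k (ch i) (ch (Suc i))"
      "\<And>k i. \<exists>j\<ge>i. extends (ch j) (ch (Suc j)) \<and> meets k (ch j) (ch (Suc j))"
    using generic_chain[of good s\<^sub>0 "\<lambda>k s t. extends s t \<and> meets k s t"] assms good_extension
    by (smt (verit, ccfv_threshold))
  note good = ch(2)[unfolded good_def]
  have mono: "mono (\<lambda>i. ptsL (ch i))" "mono (\<lambda>i. stsL (ch i))" "mono (\<lambda>i. thyL (ch i))"
    "mono (\<lambda>i. ptsR (ch i))" "mono (\<lambda>i. stsR (ch i))" "mono (\<lambda>i. thyR (ch i))"
    using ch(3) by (auto simp: mono_iff_le_Suc extends_def)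
  have le: "ptsL (ch i) \<subseteq> ptsL (ch j)" "stsL (ch i) \<subseteq> stsL (ch j)" "thyL (ch i) \<subseteq> thyL (ch j)"
    "ptsR (ch i) \<subseteq> ptsR (ch j)" "stsR (ch i) \<subseteq> stsR (ch j)" "thyR (ch i) \<subseteq> thyR (ch j)"
    if "i \<le> j" for i j
    using mono[THEN monoD, OF that] by auto
  have later: "\<exists>j\<ge>i. meets k (ch j) (ch (Suc j))" for k i using ch(4) by blast
  let ?P = "\<Union>i. ptsL (ch i)" and ?A = "\<Union>i. stsL (ch i)" and ?\<Gamma> = "\<Union>i. thyL (ch i)"
  let ?Q = "\<Union>i. ptsR (ch i)" and ?B = "\<Union>i. stsR (ch i)" and ?\<Delta> = "\<Union>i. thyR (ch i)"
  have L: "henkin ?P ?A ?\<Gamma>"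
  proof (rule henkin_limit)
    fix i \<chi>
    show "\<exists>j. \<chi> \<in> thyL (ch j) \<or> Neg \<chi> \<in> thyL (ch j)" if "wfn (ptsL (ch i)) (stsL (ch i)) \<chi>"
      using later[of i "DecL \<chi>"] wfn_mono[OF that le(1,2)] by auto
    show "\<exists>j. \<exists>c\<in>ptsL (ch j). Neg (instP c \<chi>) \<in> thyL (ch j)" if "Neg (AllP \<chi>) \<in> thyL (ch i)"
      using later[of i "WitLP \<chi>"] subsetD[OF le(3) that] by auto
    show "\<exists>j. \<exists>c\<in>stsL (ch j). Neg (instS c \<chi>) \<in> thyL (ch j)" if "Neg (AllS \<chi>) \<in> thyL (ch i)"
      using later[of i "WitLS \<chi>"] subsetD[OF le(3) that] by auto
  qed (use mono good inseparable_not_Bot in blast)+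
  have R: "henkin ?Q ?B ?\<Delta>"
  proof (rule henkin_limit)
    fix i \<chi>
    show "\<exists>j. \<chi> \<in> thyR (ch j) \<or> Neg \<chi> \<in> thyR (ch j)" if "wfn (ptsR (ch i)) (stsR (ch i)) \<chi>"
      using later[of i "DecR \<chi>"] wfn_mono[OF that le(4,5)] by auto
    show "\<exists>j. \<exists>c\<in>ptsR (ch j). Neg (instP c \<chi>) \<in> thyR (ch j)" if "Neg (AllP \<chi>) \<in> thyR (ch i)"
      using later[of i "WitRP \<chi>"] subsetD[OF le(6) that] by auto
    show "\<exists>j. \<exists>c\<in>stsR (ch j). Neg (instS c \<chi>) \<in> thyR (ch j)" if "Neg (AllS \<chi>) \<in> thyR (ch i)"
      using later[of i "WitRS \<chi>"] subsetD[OF le(6) that] by auto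
  qed (use mono good inseparable_not_Bot in blast)+
  have PQ: "?P \<subseteq> ?Q" and BA: "?B \<subseteq> ?A" using good by blast+
  have "\<theta> \<in> ?\<Delta>" if \<theta>: "flow \<theta>" "wfn ?P ?B \<theta>" "\<theta> \<in> ?\<Gamma>" for \<theta>
  proof (rule ccontr)
    assume "\<theta> \<notin> ?\<Delta>"
    moreover have "wfn ?Q ?B \<theta>" using wfn_mono[OF \<theta>(2) PQ order_refl] .
    ultimately have "Neg \<theta> \<in> ?\<Delta>" using henkin.complete[OF R] by blast
    then obtain a b where ab: "\<theta> \<in> thyL (ch a)" "Neg \<theta> \<in> thyR (ch b)" using \<theta>(3) by blast
    obtain c where c: "fvP \<theta> \<subseteq> ptsL (ch c)"
      using finite_subset_chain[OF finite_fvP _ mono(1)] \<theta>(2) unfolding wfn_def by blast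
    obtain d where d: "fvS \<theta> \<subseteq> stsR (ch d)"
      using finite_subset_chain[OF finite_fvS _ mono(5)] \<theta>(2) unfolding wfn_def by blast
    \<comment> \<open>At this stage \<theta>, its negation and all its shared names are present, so
      \<theta> itself separates the two theories.\<close>
    define k where "k = max (max a b) (max c d)"
    have "a \<le> k" "b \<le> k" "c \<le> k" "d \<le> k" by (auto simp: k_def)
    then have k: "\<theta> \<in> thyL (ch k)" "Neg \<theta> \<in> thyR (ch k)" "wfn (ptsL (ch k)) (stsR (ch k)) \<theta>"
      using ab c d le(3)[of a k] le(6)[of b k] le(1)[of c k] le(5)[of d k] unfolding wfn_def by auto
    then have "nderiv (ptsL (ch k)) (stsL (ch k)) (thyL (ch k)) \<theta>"
      "nderiv (ptsR (ch k)) (stsR (ch k)) (thyR (ch k)) (Neg \<theta>)"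
      using good[of k] by (blast intro: nderiv.Assm)+
    then show False using good[of k] k(3) \<theta>(1) unfolding inseparable_def by blast
  qed
  then show thesis using that[OF L R PQ BA] ch(1) by blast
qed

lemma inseparable_models:
  assumes inf: "infinite (UNIV :: 'p set)" "infinite (UNIV :: 's set)"
    "infinite (UNIV :: 'q set)" "infinite (UNIV :: 't set)"
    and "inseparable P\<^sub>0 A\<^sub>0 \<Gamma>\<^sub>0 Q\<^sub>0 B\<^sub>0 \<Delta>\<^sub>0" "finite Q\<^sub>0" "finite A\<^sub>0" "P\<^sub>0 \<subseteq> Q\<^sub>0" "B\<^sub>0 \<subseteq> A\<^sub>0"
    and "\<forall>\<gamma>\<in>\<Gamma>\<^sub>0. wfn P\<^sub>0 A\<^sub>0 \<gamma>" "\<forall>\<delta>\<in>\<Delta>\<^sub>0. wfn Q\<^sub>0 B\<^sub>0 \<delta>"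
  obtains C :: "('p, 's) chu" and D :: "('q, 't) chu" and f g e d e' d' where
    "chu_space C" "chu_space D" "dense_chu_transform C D f g"
    "\<forall>\<gamma>\<in>\<Gamma>\<^sub>0. sat C e d \<gamma>" "\<forall>\<delta>\<in>\<Delta>\<^sub>0. sat D e' d' \<delta>"
    "\<And>i. i \<in> P\<^sub>0 \<Longrightarrow> e i \<in> points C \<and> e' i = f (e i)" "\<And>j. j \<in> B\<^sub>0 \<Longrightarrow> d' j \<in> states D \<and> d j = g (d' j)"
proof -
  have "good \<lparr>ptsL = P\<^sub>0, stsL = A\<^sub>0, thyL = \<Gamma>\<^sub>0, ptsR = Q\<^sub>0, stsR = B\<^sub>0, thyR = \<Delta>\<^sub>0\<rparr>"
    using assms(5-) by (simp add: good_def)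
  then obtain P A \<Gamma> Q B \<Delta> where hL: "henkin P A \<Gamma>" and hR: "henkin Q B \<Delta>" and PQ: "P \<subseteq> Q"
    and BA: "B \<subseteq> A" and init: "P\<^sub>0 \<subseteq> P" "B\<^sub>0 \<subseteq> B" "\<Gamma>\<^sub>0 \<subseteq> \<Gamma>" "\<Delta>\<^sub>0 \<subseteq> \<Delta>"
    and flow: "\<And>\<theta>. flow \<theta> \<Longrightarrow> wfn P B \<theta> \<Longrightarrow> \<theta> \<in> \<Gamma> \<Longrightarrow> \<theta> \<in> \<Delta>"
    by (rule generic_pair) simp
  obtain C :: "('p, 's) chu" and e d where C: "chu_space C" "points C = e ` P" "states C = d ` A"
    and satC: "\<And>\<phi>. wfn P A \<phi> \<Longrightarrow> sat C e d \<phi> \<longleftrightarrow> \<phi> \<in> \<Gamma>"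
    by (rule henkin.term_model[OF hL inf(1,2)]) blast
  obtain D :: "('q, 't) chu" and e' d' where D: "chu_space D" "points D = e' ` Q" "states D = d' ` B"
    and satD: "\<And>\<phi>. wfn Q B \<phi> \<Longrightarrow> sat D e' d' \<phi> \<longleftrightarrow> \<phi> \<in> \<Delta>"
    by (rule henkin.term_model[OF hR inf(3,4)]) blast
  have pres: "sat D e' d' \<theta>" if "flow \<theta>" "wfn P B \<theta>" "sat C e d \<theta>" for \<theta>
  proof -
    have "wfn P A \<theta>" "wfn Q B \<theta>" using that(2) PQ BA by (auto intro: wfn_mono)
    then show ?thesis using flow satC satD that by blast
  qed
  \<comment> \<open>Both maps read off some name of their argument and interpret it on the other
    side. The flow of \<open>EqP\<close> shows that f does not depend on the name chosen, the flow
    of negated \<open>EqS\<close> that g does not.\<close>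
  define f where "f x = e' (SOME i. i \<in> P \<and> e i = x)" for x
  define g where "g y = d (SOME j. j \<in> B \<and> d' j = y)" for y
  have f: "f (e i) = e' i" if "i \<in> P" for i
  proof -
    define k where "k = (SOME k. k \<in> P \<and> e k = e i)"
    have "k \<in> P \<and> e k = e i" unfolding k_def by (rule someI[of _ i]) (simp add: that)
    then show ?thesis
      using pres[OF flow.intros(1)[of k i]] that by (simp add: f_def k_def)
  qed
  have g: "g (d' j) = d j" if "j \<in> B" for j
  proof -
    define k where "k = (SOME k. k \<in> B \<and> d' k = d' j)"
    have "k \<in> B \<and> d' k = d' j" unfolding k_def by (rule someI[of _ j]) (simp add: that)
    then show ?thesis
      using pres[OF flow.intros(2)[of k j]] that by (auto simp: g_def k_def)
  qed
  \<comment> \<open>\<open>Rel\<close> carries incidence from C to D, and its negation carries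
    non-incidence, which is the converse.\<close>
  have rel: "(e i, d j) \<in> inc C \<longleftrightarrow> (e' i, d' j) \<in> inc D" if "i \<in> P" "j \<in> B" for i j
    using pres[OF flow.intros(3)[of i j]] pres[OF flow.intros(4)[of i j]] that by auto
  have dense: "\<exists>i\<in>P. (e' i, d' j) \<in> inc D" if "j \<in> B" "y \<in> points D" "(y, d' j) \<in> inc D" for j y
  proof -
    have "\<not> sat D e' d' (Neg (ExP (Rel 0 j)))" using that by auto
    then have "\<not> sat C e d (Neg (ExP (Rel 0 j)))"
      using pres[OF flow.intros(5)[of j]] that(1) by auto
    then obtain i where "i \<in> P" "(e i, d j) \<in> inc C" using C(2) by auto
    then show ?thesis using rel that(1) by auto
  qed
  show thesis
  proof (rule that[of C D f g e d e' d'])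
    show "dense_chu_transform C D f g"
      unfolding dense_chu_transform_def chu_transform_def
    proof (intro conjI ballI impI)
      show "f \<in> points C \<rightarrow> points D" "g \<in> states D \<rightarrow> states C"
        using C D f g PQ BA by auto
      show "(x, g b) \<in> inc C \<longleftrightarrow> (f x, b) \<in> inc D" if "x \<in> points C" "b \<in> states D" for x b
        using that C D f g rel by auto
      show "\<exists>x\<in>points C. (f x, b) \<in> inc D"
        if "b \<in> states D" "\<exists>y\<in>points D. (y, b) \<in> inc D" for b
        using that C D f dense by fastforce
    qed
    show "\<forall>\<gamma>\<in>\<Gamma>\<^sub>0. sat C e d \<gamma>" using init(3) satC henkin.wf[OF hL] by blast
    show "\<forall>\<delta>\<in>\<Delta>\<^sub>0. sat D e' d' \<delta>" using init(4) satD henkin.wf[OF hR] by blast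
  qed (use C D f g init in auto)
qed

section \<open>The preservation theorem\<close>

text \<open>Inside m quantifiers an outer variable i is numbered \<open>i + m\<close>, and the
  outermost quantifier binds the variable m - 1. Peeling quantifiers from outside thus assigns the
  highest of the m variables first.\<close>

lemma sat_AllP_pow:
  "sat C (\<lambda>i. e (i + m)) d ((AllP ^^ m) \<phi>) \<Longrightarrow> \<forall>i<m. e i \<in> points C \<Longrightarrow> sat C e d \<phi>"
proof (induction m)
  case (Suc m)
  have "case_nat (e m) (\<lambda>i. e (i + Suc m)) = (\<lambda>i. e (i + m))"
    by (auto simp: fun_eq_iff split: nat.splits)
  moreover have "sat C (case_nat (e m) (\<lambda>i. e (i + Suc m))) d ((AllP ^^ m) \<phi>)"
    using Suc.prems unfolding funpow.simps comp_apply sat.simps by blast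
  ultimately show ?case using Suc by simp
qed simp

lemma sat_AllS_pow:
  "sat C e (\<lambda>i. d (i + n)) ((AllS ^^ n) \<phi>) \<Longrightarrow> \<forall>i<n. d i \<in> states C \<Longrightarrow> sat C e d \<phi>"
proof (induction n)
  case (Suc n)
  have "case_nat (d n) (\<lambda>i. d (i + Suc n)) = (\<lambda>i. d (i + n))"
    by (auto simp: fun_eq_iff split: nat.splits)
  moreover have "sat C e (case_nat (d n) (\<lambda>i. d (i + Suc n))) ((AllS ^^ n) \<phi>)"
    using Suc.prems unfolding funpow.simps comp_apply sat.simps by blast
  ultimately show ?case using Suc by simp
qed simp

section \<open>Sentences and universal closures\<close>

lemma sat_cong_wff:
  assumes "wff m n \<phi>" "\<And>i. i < m \<Longrightarrow> e i = e' i" "\<And>j. j < n \<Longrightarrow> d j = d' j"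
  shows "sat C e d \<phi> \<longleftrightarrow> sat C e' d' \<phi>"
  by (rule sat_cong) (use assms in \<open>auto simp: wff_iff_wfn wfn_def\<close>)

lemma sat_sentence: "sentence \<sigma> \<Longrightarrow> sat C e d \<sigma> \<longleftrightarrow> sat C e' d' \<sigma>"
  by (rule sat_cong_wff) auto

text \<open>\<open>models\<close> evaluates at empty lists, whose entries are unspecified; for
  sentences any assignment may take their place.\<close>

lemma models_iff:
  assumes "\<forall>\<sigma>\<in>T. sentence \<sigma>"
  shows "models C T \<longleftrightarrow> chu_space C \<and> (\<forall>\<sigma>\<in>T. sat C e d \<sigma>)"
  using assms sat_sentence unfolding models_def holds_def by blast

lemma univ_closure_sound:
  assumes "T \<turnstile> univ_closure m n \<chi>" "\<forall>\<sigma>\<in>T. sentence \<sigma>" "models C T"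
    and "\<forall>i<m. e i \<in> points C" "\<forall>j<n. d j \<in> states C"
  shows "sat C e d \<chi>"
proof -
  \<comment> \<open>The derivation has the empty context, so the shifted assignments may lie outside
    the carriers.\<close>
  have "sat C (\<lambda>i. e (i + m)) (\<lambda>j. d (j + n)) (univ_closure m n \<chi>)"
    using assms(1) unfolding proves_def
    by (rule deriv_sound)
      (use assms(3) models_iff[OF assms(2)] in blast)+
  then have "sat C e (\<lambda>j. d (j + n)) ((AllS ^^ n) \<chi>)"
    unfolding univ_closure_def using assms(4) by (rule sat_AllP_pow)
  then show ?thesis using assms(5) by (rule sat_AllS_pow)
qed

lemma deriv_univ_closure:
  assumes "\<forall>\<sigma>\<in>T. sentence \<sigma>" "deriv m n T \<chi>"
  shows "T \<turnstile> univ_closure m n \<chi>"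
proof -
  have "ren \<rho> \<pi> \<sigma> = \<sigma>" if "\<sigma> \<in> T" for \<rho> \<pi> \<sigma>
    using ren_cong[of \<sigma> \<rho> id \<pi> id] assms(1) that by (auto simp: wff_iff_wfn wfn_def)
  \<comment> \<open>Sentences are fixed by every renaming, so T satisfies the premises of quantifier
    introduction without being lifted.\<close>
  then have lift: "ren \<rho> \<pi> ` T = T" for \<rho> \<pi> by simp
  have "deriv m 0 T ((AllS ^^ n) \<chi>)" using assms(2)
  proof (induction n arbitrary: \<chi>)
    case (Suc n)
    then have "deriv m n T (AllS \<chi>)" by (simp add: deriv.AllSI lift)
    from Suc.IH[OF this] show ?case by (simp add: funpow_swap1)
  qed simp
  moreover have "deriv m 0 T \<xi> \<Longrightarrow> deriv 0 0 T ((AllP ^^ m) \<xi>)" for \<xi>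
  proof (induction m arbitrary: \<xi>)
    case (Suc m)
    then have "deriv m 0 T (AllP \<xi>)" by (simp add: deriv.AllPI lift)
    from Suc.IH[OF this] show ?case by (simp add: funpow_swap1)
  qed simp
  ultimately have "deriv 0 0 T ((AllP ^^ m) ((AllS ^^ n) \<chi>))" by blast
  then show ?thesis by (simp add: proves_def univ_closure_def)
qed

text \<open>Refuting \<theta> from \<not>\<psi> is, classically, deriving \<psi> from \<theta>; a
  separator is therefore an interpolant.\<close>

lemma separated_imp_interpolant:
  assumes "nderiv P S (insert \<phi> \<Gamma>) \<theta>" "nderiv P S (insert (Neg \<psi>) \<Gamma>) (Neg \<theta>)"
    and "wfn P S \<phi>" "wfn P S \<psi>"
  shows "nderiv P S \<Gamma> (And (Imp \<phi> \<theta>) (Imp \<theta> \<psi>))"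
proof (intro nderiv_AndI)
  show "nderiv P S \<Gamma> (Imp \<phi> \<theta>)" using assms(3,1) by (rule nderiv.ImpI)
  have \<theta>: "wfn P S \<theta>" using assms(1) by (rule nderiv_wfn)
  have "nderiv P S (insert \<theta> (insert (Neg \<psi>) \<Gamma>)) Bot"
    using nderiv_insert[OF assms(2)] nderiv_self[OF \<theta>] by (rule nderiv.ImpE)
  then have "nderiv P S (insert \<theta> \<Gamma>) \<psi>"
    by (intro nderiv.Raa[OF assms(4)]) (simp add: insert_commute)
  then show "nderiv P S \<Gamma> (Imp \<theta> \<psi>)" by (rule nderiv.ImpI[OF \<theta>])
qed

theorem theorem4p14:
  fixes T :: "fm set" and \<phi> \<psi> :: fm and m n :: nat
  assumes "infinite (UNIV :: 'p set)" and "infinite (UNIV :: 's set)"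
    and "infinite (UNIV :: 'q set)" and "infinite (UNIV :: 't set)"
    and "\<forall>\<sigma>\<in>T. sentence \<sigma>" and "wff m n \<phi>" and "wff m n \<psi>"
  shows "(\<forall>(C :: ('p, 's) chu) (D :: ('q, 't) chu) f g.
            models C T \<and> models D T \<and> dense_chu_transform C D f g \<longrightarrow>
            (\<forall>xs bs. length xs = m \<and> set xs \<subseteq> points C \<and> length bs = n \<and> set bs \<subseteq> states D \<longrightarrow>
               holds C xs (map g bs) \<phi> \<longrightarrow> holds D (map f xs) bs \<psi>))
         \<longleftrightarrow>
         (\<exists>\<theta>. flow \<theta> \<and> wff m n \<theta> \<and>
            T \<turnstile> univ_closure m n (And (Imp \<phi> \<theta>) (Imp \<theta> \<psi>)))"
  (is "?preserved \<longleftrightarrow> ?interpolated")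
proof
  assume ?interpolated
  then obtain \<theta> where \<theta>: "flow \<theta>" "wff m n \<theta>"
    "T \<turnstile> univ_closure m n (And (Imp \<phi> \<theta>) (Imp \<theta> \<psi>))" by blast
  show ?preserved
  proof (intro allI impI, elim conjE)
    fix C :: "('p, 's) chu" and D :: "('q, 't) chu" and f g xs bs
    assume mod: "models C T" "models D T" and dense: "dense_chu_transform C D f g"
      and xs: "length xs = m" "set xs \<subseteq> points C" and bs: "length bs = n" "set bs \<subseteq> states D"
      and holds: "holds C xs (map g bs) \<phi>"
    have f: "f \<in> points C \<rightarrow> points D" and g: "g \<in> states D \<rightarrow> states C"
      using dense by (auto simp: dense_chu_transform_def chu_transform_def)
    have C: "\<forall>i<m. xs ! i \<in> points C" "\<forall>j<n. map g bs ! j \<in> states C"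
      and D: "\<forall>i<m. map f xs ! i \<in> points D" "\<forall>j<n. bs ! j \<in> states D"
      using f g xs bs by (auto simp: subset_eq Pi_iff)
    have "sat C ((!) xs) ((!) (map g bs)) \<theta>"
      using univ_closure_sound[OF \<theta>(3) assms(5) mod(1) C] holds by (simp add: holds_def)
    \<comment> \<open>The assignments from \<open>map g bs\<close> and from composition with g are
      known to agree only below n, which is enough for the variables of \<theta>.\<close>
    then have "sat C ((!) xs) (g \<circ> (!) bs) \<theta>"
      by (rule iffD1[OF sat_cong_wff[OF \<theta>(2)], rotated -1]) (simp_all add: bs(1))
    then have "sat D (f \<circ> (!) xs) ((!) bs) \<theta>"
      using \<theta>(2) C(1) D(2) unfolding wff_iff_wfn by (intro flow_preserved[OF dense \<theta>(1)]) auto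
    then have "sat D ((!) (map f xs)) ((!) bs) \<theta>"
      by (rule iffD1[OF sat_cong_wff[OF \<theta>(2)], rotated -1]) (simp_all add: xs(1))
    then show "holds D (map f xs) bs \<psi>"
      using univ_closure_sound[OF \<theta>(3) assms(5) mod(2) D] by (simp add: holds_def)
  qed
next
  assume preserved: ?preserved
  show ?interpolated
  proof (rule ccontr)
    assume none: "\<not> ?interpolated"
    let ?P = "{..<m}" and ?S = "{..<n}"
    have wf: "wfn ?P ?S \<phi>" "wfn ?P ?S \<psi>" "\<forall>\<sigma>\<in>T. wfn ?P ?S \<sigma>"
      using assms(5-7) by (auto simp: wff_iff_wfn wfn_def)
    \<comment> \<open>Both theories start with the same names, so a separator is a formula in the
      variables allowed for the interpolant.\<close>
    have "inseparable ?P ?S (insert \<phi> T) ?P ?S (insert (Neg \<psi>) T)"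
      unfolding inseparable_def
    proof (rule notI, elim exE conjE)
      fix \<theta> assume \<theta>: "flow \<theta>" "wfn ?P ?S \<theta>"
        "nderiv ?P ?S (insert \<phi> T) \<theta>" "nderiv ?P ?S (insert (Neg \<psi>) T) (Neg \<theta>)"
      have "deriv m n T (And (Imp \<phi> \<theta>) (Imp \<theta> \<psi>))"
        using separated_imp_interpolant[OF \<theta>(3,4) wf(1,2)] by (rule nderiv_imp_deriv) simp_all
      then show False
        using none \<theta>(1,2) deriv_univ_closure[OF assms(5)] unfolding wff_iff_wfn by blast
    qed
    then obtain C :: "('p, 's) chu" and D :: "('q, 't) chu" and f g e d e' d' where
      chu: "chu_space C" "chu_space D" "dense_chu_transform C D f g"
      and sat: "\<forall>\<gamma>\<in>insert \<phi> T. sat C e d \<gamma>" "\<forall>\<delta>\<in>insert (Neg \<psi>) T. sat D e' d' \<delta>"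
      and e: "\<And>i. i \<in> ?P \<Longrightarrow> e i \<in> points C \<and> e' i = f (e i)"
      and d: "\<And>j. j \<in> ?S \<Longrightarrow> d' j \<in> states D \<and> d j = g (d' j)"
      by (rule inseparable_models[OF assms(1-4)]) (use wf in auto)
    define xs bs where "xs = map e [0..<m]" and "bs = map d' [0..<n]"
    have "models C T" "models D T"
      using chu(1,2) sat models_iff[OF assms(5)] by blast+
    moreover have "set xs \<subseteq> points C" "set bs \<subseteq> states D" "length xs = m" "length bs = n"
      using e d by (auto simp: xs_def bs_def)
    moreover have "holds C xs (map g bs) \<phi>"
      unfolding holds_def
      by (rule iffD1[OF sat_cong_wff[OF assms(6), of e _ d]])
        (use sat(1) d in \<open>simp_all add: xs_def bs_def\<close>)
    ultimately have "holds D (map f xs) bs \<psi>" using preserved chu(3) by blast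
    then have "sat D e' d' \<psi>"
      unfolding holds_def
      by (rule iffD1[OF sat_cong_wff[OF assms(7)], rotated -1])
        (use e in \<open>simp_all add: xs_def bs_def\<close>)
    then show False using sat(2) by simp
  qed
qed

end
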